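(* Let $G$ be a finitely generated torsion-free nilpotent group of class $2$ whose abelianization is torsion-free. Put $A=G/G'\cong\mathbb Z^d$ and $C=G'\cong\mathbb Z^c$, and let $\beta:\wedge^2A\twoheadrightarrow C$ be the surjective homomorphism induced by the commutator map $G\times G\to C$, i.e. $\beta(gG'\wedge hG')=[g,h]$. Put $L_\beta=\ker\beta$ and $D_\beta=\langle a\wedge b\mid a,b\in A,\ \beta(a\wedge b)=0\rangle\le L_\beta$. Then $B_0(G)\cong L_\beta/D_\beta$.
   Context: For a group $G$ with free presentation $G=F/R$, the nonabelian exterior square $G\wedge G$ (Brown–Loday) is identified with the commutator subgroup of $F/[F,R]$; under this identification $g\wedge h$ corresponds to $[\widehat g,\widehat h]$ for arbitrary lifts $\widehat g,\widehat h\in F/[F,R]$ of $g,h$. The Schur multiplier $M(G)=H_2(G,\mathbb Z)$ is identified with the kernel of the commutator map $\kappa:G\wedge G\to G'$, $g\wedge h\mapsto[g,h]$. Put $M_0(G)=\langle x\wedge y\mid x,y\in G,\ [x,y]=1\rangle\le M(G)$. The (homological) Bogomolov multiplier of $G$ is $B_0(G)=M(G)/M_0(G)$. *)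

theory Defs
  imports "HOL-Algebra.Generated_Groups" "HOL-Algebra.Free_Abelian_Groups"
begin

section \<open>Finitely generated torsion-free nilpotent groups\<close>

definition finitely_generated_group :: "('a, 'b) monoid_scheme \<Rightarrow> bool" where
  "finitely_generated_group G \<longleftrightarrow>
     (\<exists>S. finite S \<and> S \<subseteq> carrier G \<and> generate G S = carrier G)"

definition torsion_free_group :: "('a, 'b) monoid_scheme \<Rightarrow> bool" where
  "torsion_free_group G \<longleftrightarrow>
     (\<forall>x \<in> carrier G. \<forall>n::nat. n > 0 \<longrightarrow> x [^]\<^bsub>G\<^esub> n = \<one>\<^bsub>G\<^esub> \<longrightarrow> x = \<one>\<^bsub>G\<^esub>)"

text \<open>The same convention for \<open>[g, h]\<close> as in the library's \<^term>\<open>derived\<close>.\<close>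

definition commutator :: "('a, 'b) monoid_scheme \<Rightarrow> 'a \<Rightarrow> 'a \<Rightarrow> 'a" where
  "commutator G g h = g \<otimes>\<^bsub>G\<^esub> h \<otimes>\<^bsub>G\<^esub> inv\<^bsub>G\<^esub> g \<otimes>\<^bsub>G\<^esub> inv\<^bsub>G\<^esub> h"

text \<open>Indexed from 0, so that a group of class \<open>c\<close> is one whose \<open>c\<close>-th term is the first
  trivial one.\<close>

primrec lower_central :: "('a, 'b) monoid_scheme \<Rightarrow> nat \<Rightarrow> 'a set" where
  "lower_central G 0 = carrier G"
| "lower_central G (Suc n) =
     generate G {commutator G x g |x g. x \<in> lower_central G n \<and> g \<in> carrier G}"

definition nilpotent_of_class :: "('a, 'b) monoid_scheme \<Rightarrow> nat \<Rightarrow> bool" where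
  "nilpotent_of_class G c \<longleftrightarrow>
     lower_central G c = {\<one>\<^bsub>G\<^esub>} \<and> (\<forall>m < c. lower_central G m \<noteq> {\<one>\<^bsub>G\<^esub>})"

abbreviation derived_subgroup :: "('a, 'b) monoid_scheme \<Rightarrow> 'a set" where
  "derived_subgroup G \<equiv> derived G (carrier G)"

abbreviation derived_group :: "('a, 'b) monoid_scheme \<Rightarrow> ('a, 'b) monoid_scheme" where
  "derived_group G \<equiv> G\<lparr>carrier := derived_subgroup G\<rparr>"

abbreviation abelianization :: "('a, 'b) monoid_scheme \<Rightarrow> 'a set monoid" where
  "abelianization G \<equiv> G Mod derived_subgroup G"

section \<open>Groups given by generators and relations\<close>

text \<open>The letter \<open>(x, True)\<close> stands for the generator \<open>x\<close> and \<open>(x, False)\<close> for its inverse; a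
  pair \<open>(u, v)\<close> in \<open>R\<close> is the relation \<open>u = v\<close>. The elements of the presented group are the
  classes of words for the least congruence that contains \<open>R\<close> and free cancellation.\<close>

type_synonym 'x word = "('x \<times> bool) list"

definition words :: "'x set \<Rightarrow> 'x word set" where
  "words X = lists (X \<times> UNIV)"

inductive word_equiv :: "'x set \<Rightarrow> ('x word \<times> 'x word) set \<Rightarrow> 'x word \<Rightarrow> 'x word \<Rightarrow> bool"
  for X R where
  relation: "(u, v) \<in> R \<Longrightarrow> u \<in> words X \<Longrightarrow> v \<in> words X \<Longrightarrow> word_equiv X R u v"
| cancel: "x \<in> X \<Longrightarrow> word_equiv X R [(x, b), (x, \<not> b)] []"
| refl: "u \<in> words X \<Longrightarrow> word_equiv X R u u"
| sym: "word_equiv X R u v \<Longrightarrow> word_equiv X R v u"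
| trans: "word_equiv X R u v \<Longrightarrow> word_equiv X R v w \<Longrightarrow> word_equiv X R u w"
| append: "word_equiv X R u u' \<Longrightarrow> word_equiv X R v v' \<Longrightarrow> word_equiv X R (u @ v) (u' @ v')"

definition word_class :: "'x set \<Rightarrow> ('x word \<times> 'x word) set \<Rightarrow> 'x word \<Rightarrow> 'x word set" where
  "word_class X R u = {w. word_equiv X R u w}"

definition presented_group :: "'x set \<Rightarrow> ('x word \<times> 'x word) set \<Rightarrow> 'x word set monoid" where
  "presented_group X R =
     \<lparr>carrier = word_class X R ` words X,
      monoid.mult = (\<lambda>U V. {w. \<exists>u\<in>U. \<exists>v\<in>V. word_equiv X R (u @ v) w}),
      one = word_class X R []\<rparr>"

primrec word_eval :: "('a, 'b) monoid_scheme \<Rightarrow> ('x \<Rightarrow> 'a) \<Rightarrow> 'x word \<Rightarrow> 'a" where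
  "word_eval H f [] = \<one>\<^bsub>H\<^esub>"
| "word_eval H f (l # w) =
     (if snd l then f (fst l) else inv\<^bsub>H\<^esub> (f (fst l))) \<otimes>\<^bsub>H\<^esub> word_eval H f w"

text \<open>The map on a presented group induced by a map \<open>f\<close> of the generators into \<open>H\<close>; by
  \<open>presented_lift_hom\<close> it does not depend on the chosen representative if \<open>f\<close> respects the
  relations.\<close>

definition presented_lift :: "('a, 'b) monoid_scheme \<Rightarrow> ('x \<Rightarrow> 'a) \<Rightarrow> 'x word set \<Rightarrow> 'a" where
  "presented_lift H f U = word_eval H f (SOME u. u \<in> U)"

lemma words_simps [simp]:
  "[] \<in> words X" "l # u \<in> words X \<longleftrightarrow> fst l \<in> X \<and> u \<in> words X"
  "u @ v \<in> words X \<longleftrightarrow> u \<in> words X \<and> v \<in> words X"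
  by (auto simp: words_def mem_Times_iff)

lemma word_equiv_words: "word_equiv X R u v \<Longrightarrow> u \<in> words X \<and> v \<in> words X"
  by (induction rule: word_equiv.induct) auto

lemma word_class_eq:
  assumes "word_equiv X R u v"
  shows "word_class X R u = word_class X R v"
  using assms unfolding word_class_def by (blast intro: word_equiv.sym word_equiv.trans)

lemma word_class_self: "u \<in> words X \<Longrightarrow> u \<in> word_class X R u"
  by (simp add: word_class_def word_equiv.refl)

lemma presented_mult:
  assumes "u \<in> words X" "v \<in> words X"
  shows "word_class X R u \<otimes>\<^bsub>presented_group X R\<^esub> word_class X R v = word_class X R (u @ v)"
  using assms unfolding presented_group_def word_class_def
  by (auto intro: word_equiv.intros)

lemma word_inverse:
  "u \<in> words X \<Longrightarrow>
     \<exists>v \<in> words X. word_equiv X R (v @ u) []"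
proof (induction u)
  case Nil
  have "word_equiv X R [] []" by (rule word_equiv.refl) simp
  then show ?case by (intro bexI[of _ "[]"]) auto
next
  case (Cons l u)
  then obtain v where v: "v \<in> words X" "word_equiv X R (v @ u) []" by auto
  obtain x b where l: "l = (x, b)" by (cases l)
  have x: "x \<in> X" and u: "u \<in> words X" using Cons.prems l by auto
  have "word_equiv X R [(x, \<not> b), (x, \<not> \<not> b)] []" by (rule word_equiv.cancel[OF x])
  then have "word_equiv X R ([(x, \<not> b), l] @ u) ([] @ u)"
    using word_equiv.append word_equiv.refl[OF u] l by (metis (full_types))
  then have "word_equiv X R (v @ [(x, \<not> b), l] @ u) (v @ [] @ u)"
    by (rule word_equiv.append[OF word_equiv.refl[OF v(1)]])
  with v have "word_equiv X R ((v @ [(x, \<not> b)]) @ l # u) []"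
    by (auto intro: word_equiv.trans)
  with v x show ?case by (intro bexI[of _ "v @ [(x, \<not> b)]"]) auto
qed

lemma presented_group_is_group: "group (presented_group X R)"
proof (rule groupI)
  let ?P = "presented_group X R"
  have carr: "carrier ?P = word_class X R ` words X"
    and one: "\<one>\<^bsub>?P\<^esub> = word_class X R []"
    by (simp_all add: presented_group_def)
  show "x \<otimes>\<^bsub>?P\<^esub> y \<in> carrier ?P" if "x \<in> carrier ?P" "y \<in> carrier ?P" for x y
    using that by (auto simp: carr presented_mult)
  show "\<one>\<^bsub>?P\<^esub> \<in> carrier ?P" by (simp add: carr one)
  show "x \<otimes>\<^bsub>?P\<^esub> y \<otimes>\<^bsub>?P\<^esub> z = x \<otimes>\<^bsub>?P\<^esub> (y \<otimes>\<^bsub>?P\<^esub> z)"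
    if "x \<in> carrier ?P" "y \<in> carrier ?P" "z \<in> carrier ?P" for x y z
    using that by (auto simp: carr presented_mult)
  show "\<one>\<^bsub>?P\<^esub> \<otimes>\<^bsub>?P\<^esub> x = x" if "x \<in> carrier ?P" for x
    using that by (auto simp: carr one presented_mult)
  show "\<exists>y\<in>carrier ?P. y \<otimes>\<^bsub>?P\<^esub> x = \<one>\<^bsub>?P\<^esub>" if "x \<in> carrier ?P" for x
  proof -
    obtain u where u: "u \<in> words X" "x = word_class X R u" using \<open>x \<in> carrier ?P\<close> by (auto simp: carr)
    obtain v where v: "v \<in> words X" "word_equiv X R (v @ u) []" using word_inverse[OF u(1)] by blast
    show ?thesis
      using u v by (intro bexI[of _ "word_class X R v"]) (auto simp: carr one presented_mult word_class_eq)
  qed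
qed

context group begin

lemma word_eval_closed:
  "f ` X \<subseteq> carrier G \<Longrightarrow> u \<in> words X \<Longrightarrow> word_eval G f u \<in> carrier G"
  by (induction u) auto

lemma word_eval_append:
  "f ` X \<subseteq> carrier G \<Longrightarrow> u \<in> words X \<Longrightarrow> v \<in> words X \<Longrightarrow>
     word_eval G f (u @ v) = word_eval G f u \<otimes> word_eval G f v"
  by (induction u) (auto simp: word_eval_closed m_assoc image_subset_iff)

lemma word_eval_equiv:
  assumes f: "f ` X \<subseteq> carrier G"
    and R: "\<And>u v. (u, v) \<in> R \<Longrightarrow> u \<in> words X \<Longrightarrow> v \<in> words X \<Longrightarrow> word_eval G f u = word_eval G f v"
    and "word_equiv X R u v"
  shows "word_eval G f u = word_eval G f v"
  using \<open>word_equiv X R u v\<close>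
proof induction
  case (cancel x b)
  then show ?case using f by (cases b) auto
next
  case (append u u' v v')
  then show ?case using word_equiv_words[of X R] by (metis f word_eval_append)
qed (auto intro: R)

lemma presented_lift_class:
  assumes f: "f ` X \<subseteq> carrier G"
    and R: "\<And>u v. (u, v) \<in> R \<Longrightarrow> u \<in> words X \<Longrightarrow> v \<in> words X \<Longrightarrow> word_eval G f u = word_eval G f v"
    and u: "u \<in> words X"
  shows "presented_lift G f (word_class X R u) = word_eval G f u"
proof -
  have "(SOME w. w \<in> word_class X R u) \<in> word_class X R u"
    using word_class_self[OF u] by (rule someI)
  then have "word_equiv X R u (SOME w. w \<in> word_class X R u)"
    by (simp add: word_class_def)
  from word_eval_equiv[OF f R this] show ?thesis by (simp add: presented_lift_def)
qed

lemma presented_lift_hom: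
  assumes f: "f ` X \<subseteq> carrier G"
    and R: "\<And>u v. (u, v) \<in> R \<Longrightarrow> u \<in> words X \<Longrightarrow> v \<in> words X \<Longrightarrow> word_eval G f u = word_eval G f v"
  shows "presented_lift G f \<in> hom (presented_group X R) G"
    and "x \<in> X \<Longrightarrow> presented_lift G f (word_class X R [(x, True)]) = f x"
proof -
  have carr: "carrier (presented_group X R) = word_class X R ` words X"
    by (simp add: presented_group_def)
  show "presented_lift G f \<in> hom (presented_group X R) G"
    by (rule homI)
      (auto simp: carr presented_lift_class[OF f R] word_eval_closed[OF f] presented_mult
        word_eval_append[OF f])
  show "presented_lift G f (word_class X R [(x, True)]) = f x" if "x \<in> X"
    using that f by (subst presented_lift_class[OF f R]) auto
qed

end

section \<open>The nonabelian exterior square and the Bogomolov multiplier\<close>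

text \<open>The Brown--Loday relations, with \<open>\<^sup>gx = g x g\<inverse>\<close>:
  \<open>gg' \<and> h = (\<^sup>gg' \<and> \<^sup>gh)(g \<and> h)\<close>, \<open>g \<and> hh' = (g \<and> h)(\<^sup>hg \<and> \<^sup>hh')\<close> and \<open>g \<and> g = 1\<close>.\<close>

definition conjugate :: "('a, 'b) monoid_scheme \<Rightarrow> 'a \<Rightarrow> 'a \<Rightarrow> 'a" where
  "conjugate G g x = g \<otimes>\<^bsub>G\<^esub> x \<otimes>\<^bsub>G\<^esub> inv\<^bsub>G\<^esub> g"

definition exterior_relations :: "('a, 'b) monoid_scheme \<Rightarrow> (('a \<times> 'a) word \<times> ('a \<times> 'a) word) set" where
  "exterior_relations G =
     {([((g \<otimes>\<^bsub>G\<^esub> g', h), True)], [((conjugate G g g', conjugate G g h), True), ((g, h), True)])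
        |g g' h. g \<in> carrier G \<and> g' \<in> carrier G \<and> h \<in> carrier G} \<union>
     {([((g, h \<otimes>\<^bsub>G\<^esub> h'), True)], [((g, h), True), ((conjugate G h g, conjugate G h h'), True)])
        |g h h'. g \<in> carrier G \<and> h \<in> carrier G \<and> h' \<in> carrier G} \<union>
     {([((g, g), True)], []) |g. g \<in> carrier G}"

definition nonabelian_exterior_square :: "('a, 'b) monoid_scheme \<Rightarrow> ('a \<times> 'a) word set monoid" where
  "nonabelian_exterior_square G = presented_group (carrier G \<times> carrier G) (exterior_relations G)"

definition nwedge :: "('a, 'b) monoid_scheme \<Rightarrow> 'a \<Rightarrow> 'a \<Rightarrow> ('a \<times> 'a) word set" where
  "nwedge G g h = word_class (carrier G \<times> carrier G) (exterior_relations G) [((g, h), True)]"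

definition commutator_map :: "('a, 'b) monoid_scheme \<Rightarrow> ('a \<times> 'a) word set \<Rightarrow> 'a" where
  "commutator_map G = presented_lift G (\<lambda>(g, h). commutator G g h)"

text \<open>The kernel of \<open>\<kappa> : G \<and> G \<rightarrow> G'\<close>, which is identified with \<open>H\<^sub>2(G, \<int>)\<close>.\<close>

definition schur_multiplier :: "('a, 'b) monoid_scheme \<Rightarrow> ('a \<times> 'a) word set monoid" where
  "schur_multiplier G =
     (nonabelian_exterior_square G)
       \<lparr>carrier := kernel (nonabelian_exterior_square G) (derived_group G) (commutator_map G)\<rparr>"

definition schur_multiplier_0 :: "('a, 'b) monoid_scheme \<Rightarrow> ('a \<times> 'a) word set set" where
  "schur_multiplier_0 G =
     generate (nonabelian_exterior_square G)
       {nwedge G x y |x y. x \<in> carrier G \<and> y \<in> carrier G \<and> commutator G x y = \<one>\<^bsub>G\<^esub>}"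

definition bogomolov_multiplier :: "('a, 'b) monoid_scheme \<Rightarrow> ('a \<times> 'a) word set set monoid" where
  "bogomolov_multiplier G = schur_multiplier G Mod schur_multiplier_0 G"

lemma nonabelian_exterior_square_is_group: "group (nonabelian_exterior_square G)"
  unfolding nonabelian_exterior_square_def by (rule presented_group_is_group)

lemma (in group) commutator_closed [simp]:
  "g \<in> carrier G \<Longrightarrow> h \<in> carrier G \<Longrightarrow> commutator G g h \<in> carrier G"
  by (simp add: commutator_def)

lemma (in group) commutator_derived:
  "g \<in> carrier G \<Longrightarrow> h \<in> carrier G \<Longrightarrow> commutator G g h \<in> derived_subgroup G"
  unfolding derived_def commutator_def by (rule generate.incl) blast

lemma (in group) l_cancel_inv:
  "x \<in> carrier G \<Longrightarrow> y \<in> carrier G \<Longrightarrow> inv x \<otimes> (x \<otimes> y) = y"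
  "x \<in> carrier G \<Longrightarrow> y \<in> carrier G \<Longrightarrow> x \<otimes> (inv x \<otimes> y) = y"
  by (simp_all flip: m_assoc)

lemma (in group) commutator_respects:
  assumes "(u, v) \<in> exterior_relations G"
  shows "word_eval G (\<lambda>(g, h). commutator G g h) u = word_eval G (\<lambda>(g, h). commutator G g h) v"
  using assms
  by (auto simp: exterior_relations_def commutator_def conjugate_def m_assoc inv_mult_group
      l_cancel_inv)

lemma (in group) commutator_map_hom:
  shows "commutator_map G \<in> hom (nonabelian_exterior_square G) (derived_group G)"
    and "g \<in> carrier G \<Longrightarrow> h \<in> carrier G \<Longrightarrow> commutator_map G (nwedge G g h) = commutator G g h"
proof -
  let ?X = "carrier G \<times> carrier G" and ?f = "\<lambda>(g, h). commutator G g h"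
  have f: "?f ` ?X \<subseteq> carrier G" by auto
  note lift = presented_lift_hom[of ?f ?X "exterior_relations G", OF f commutator_respects]
  note lift_class = presented_lift_class[of ?f ?X "exterior_relations G", OF f commutator_respects]
  interpret D: subgroup "derived_subgroup G" G by (rule derived_is_subgroup) simp
  have "word_eval G ?f u \<in> derived_subgroup G" if "u \<in> words ?X" for u
    using that by (induction u) (auto simp: commutator_derived split: prod.splits)
  then have "commutator_map G U \<in> derived_subgroup G"
    if "U \<in> carrier (nonabelian_exterior_square G)" for U
    using that
    by (auto simp: commutator_map_def nonabelian_exterior_square_def presented_group_def lift_class)
  with lift(1) show "commutator_map G \<in> hom (nonabelian_exterior_square G) (derived_group G)"
    by (auto simp: hom_def commutator_map_def nonabelian_exterior_square_def)
  show "commutator_map G (nwedge G g h) = commutator G g h"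
    if "g \<in> carrier G" "h \<in> carrier G"
    using lift(2)[of "(g, h)"] that by (simp add: commutator_map_def nwedge_def)
qed

section \<open>The exterior square of an abelian group\<close>

text \<open>\<open>A\<close> is written multiplicatively, while its exterior square is the quotient of the (additively
  written) free abelian group on \<open>A \<times> A\<close> by the bilinear and alternating relations.\<close>

definition bilinear_relations :: "('a, 'b) monoid_scheme \<Rightarrow> ('a \<times> 'a \<Rightarrow>\<^sub>0 int) set" where
  "bilinear_relations A =
     {frag_of (a \<otimes>\<^bsub>A\<^esub> a', b) - frag_of (a, b) - frag_of (a', b)
        |a a' b. a \<in> carrier A \<and> a' \<in> carrier A \<and> b \<in> carrier A} \<union>
     {frag_of (a, b \<otimes>\<^bsub>A\<^esub> b') - frag_of (a, b) - frag_of (a, b')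
        |a b b'. a \<in> carrier A \<and> b \<in> carrier A \<and> b' \<in> carrier A}"

definition alternating_relations :: "('a, 'b) monoid_scheme \<Rightarrow> ('a \<times> 'a \<Rightarrow>\<^sub>0 int) set" where
  "alternating_relations A = {frag_of (a, a) |a. a \<in> carrier A}"

definition exterior_kernel :: "('a, 'b) monoid_scheme \<Rightarrow> ('a \<times> 'a \<Rightarrow>\<^sub>0 int) set" where
  "exterior_kernel A =
     generate (free_Abelian_group (carrier A \<times> carrier A))
       (bilinear_relations A \<union> alternating_relations A)"

definition exterior_square :: "('a, 'b) monoid_scheme \<Rightarrow> ('a \<times> 'a \<Rightarrow>\<^sub>0 int) set monoid" where
  "exterior_square A = free_Abelian_group (carrier A \<times> carrier A) Mod exterior_kernel A"

definition wedge :: "('a, 'b) monoid_scheme \<Rightarrow> 'a \<Rightarrow> 'a \<Rightarrow> ('a \<times> 'a \<Rightarrow>\<^sub>0 int) set" where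
  "wedge A a b = exterior_kernel A #>\<^bsub>free_Abelian_group (carrier A \<times> carrier A)\<^esub> frag_of (a, b)"

definition decomposable_kernel ::
  "('a, 'b) monoid_scheme \<Rightarrow> ('c, 'd) monoid_scheme \<Rightarrow> (('a \<times> 'a \<Rightarrow>\<^sub>0 int) set \<Rightarrow> 'c) \<Rightarrow>
     ('a \<times> 'a \<Rightarrow>\<^sub>0 int) set set" where
  "decomposable_kernel A C \<beta> =
     generate (exterior_square A)
       {wedge A a b |a b. a \<in> carrier A \<and> b \<in> carrier A \<and> \<beta> (wedge A a b) = \<one>\<^bsub>C\<^esub>}"

section \<open>The pairing induced by the commutator map in class 2\<close>

lemma (in comm_group) free_hom_diff:
  assumes \<phi>: "\<phi> \<in> hom (free_Abelian_group S) G"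
    and uvw: "u \<in> carrier (free_Abelian_group S)" "v \<in> carrier (free_Abelian_group S)"
      "w \<in> carrier (free_Abelian_group S)"
    and eq: "\<phi> u = \<phi> v \<otimes> \<phi> w"
  shows "\<phi> (u - v - w) = \<one>"
proof -
  have cl: "\<phi> x \<in> carrier G" if "x \<in> carrier (free_Abelian_group S)" for x
    using \<phi> that by (rule hom_in_carrier)
  have vw: "v + w \<in> carrier (free_Abelian_group S)"
    using uvw monoid.m_closed[of "free_Abelian_group S" v w] group_free_Abelian_group[of S]
    by (metis group.is_monoid mult_free_Abelian_group)
  have d: "u - v - w \<in> carrier (free_Abelian_group S)"
    using uvw by simp (meson Un_least keys_diff order_trans)
  have "\<phi> ((u - v - w) + (v + w)) = \<phi> (u - v - w) \<otimes> (\<phi> v \<otimes> \<phi> w)"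
    using hom_mult[OF \<phi> d vw] hom_mult[OF \<phi> uvw(2,3)] by simp
  then have "\<phi> v \<otimes> \<phi> w = \<phi> (u - v - w) \<otimes> (\<phi> v \<otimes> \<phi> w)"
    using eq by simp
  then show ?thesis
    using cl[OF d] cl[OF uvw(2)] cl[OF uvw(3)] by (metis m_closed r_cancel_one')
qed

text \<open>The homomorphism in \<open>commutator_pairing_exists\<close> is unique on the carrier, since the
  elements \<open>a \<and> b\<close> generate the exterior square.\<close>

context group begin

lemma derived_central:
  assumes "nilpotent_of_class G 2" "c \<in> derived_subgroup G" "g \<in> carrier G"
  shows "c \<otimes> g = g \<otimes> c"
proof -
  have "derived_set G (carrier G) = {commutator G x g |x g. x \<in> carrier G \<and> g \<in> carrier G}"
    unfolding commutator_def by blast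
  then have "lower_central G 1 = derived_subgroup G" by (simp add: derived_def)
  then have "generate G {commutator G x g |x g. x \<in> derived_subgroup G \<and> g \<in> carrier G} = {\<one>}"
    using assms(1) by (simp add: nilpotent_of_class_def numeral_2_eq_2)
  moreover have "commutator G c g
      \<in> generate G {commutator G x g |x g. x \<in> derived_subgroup G \<and> g \<in> carrier G}"
    using assms by (intro generate.incl) blast
  ultimately have "commutator G c g = \<one>" by simp
  moreover have c: "c \<in> carrier G" using assms(2) derived_in_carrier by blast
  moreover have "c \<otimes> g = commutator G c g \<otimes> (g \<otimes> c)"
    using c assms(3) by (simp add: commutator_def m_assoc l_cancel_inv)
  ultimately show ?thesis using assms(3) by simp
qed

lemma commutator_mult_class2:
  assumes nil: "nilpotent_of_class G 2"
    and [simp]: "x \<in> carrier G" "y \<in> carrier G" "z \<in> carrier G"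
  shows "commutator G (x \<otimes> y) z = commutator G x z \<otimes> commutator G y z"
    and "commutator G z (x \<otimes> y) = commutator G z x \<otimes> commutator G z y"
proof -
  have "commutator G (x \<otimes> y) z = x \<otimes> commutator G y z \<otimes> (inv x \<otimes> commutator G x z)"
    by (simp add: commutator_def m_assoc inv_mult_group l_cancel_inv)
  also have "\<dots> = commutator G y z \<otimes> commutator G x z"
    unfolding derived_central[OF nil commutator_derived[OF assms(3,4)] assms(2), symmetric]
    by (simp add: m_assoc l_cancel_inv)
  also have "\<dots> = commutator G x z \<otimes> commutator G y z"
    by (rule derived_central[OF nil commutator_derived]) auto
  finally show "commutator G (x \<otimes> y) z = commutator G x z \<otimes> commutator G y z" .
  have "commutator G z (x \<otimes> y) = commutator G z x \<otimes> (x \<otimes> commutator G z y \<otimes> inv x)"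
    by (simp add: commutator_def m_assoc inv_mult_group l_cancel_inv)
  also have "x \<otimes> commutator G z y \<otimes> inv x = commutator G z y"
    unfolding derived_central[OF nil commutator_derived[OF assms(4,3)] assms(2), symmetric]
    by (simp add: m_assoc)
  finally show "commutator G z (x \<otimes> y) = commutator G z x \<otimes> commutator G z y" .
qed

lemma commutator_derived_left:
  assumes nil: "nilpotent_of_class G 2" and c: "c \<in> derived_subgroup G" and g: "g \<in> carrier G"
  shows "commutator G c g = \<one>" "commutator G g c = \<one>"
proof -
  have [simp]: "c \<in> carrier G" using c derived_in_carrier by blast
  show "commutator G c g = \<one>" "commutator G g c = \<one>"
    using g derived_central[OF nil c g] derived_central[OF nil c, of "inv g"]
    unfolding commutator_def by (simp_all add: m_assoc l_cancel_inv)
qed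

lemma commutator_self [simp]: "g \<in> carrier G \<Longrightarrow> commutator G g g = \<one>"
  by (simp add: commutator_def m_assoc)

theorem commutator_pairing_exists:
  assumes nil: "nilpotent_of_class G 2"
  obtains \<beta> where "\<beta> \<in> epi (exterior_square (abelianization G)) (derived_group G)"
    and "\<And>g h. g \<in> carrier G \<Longrightarrow> h \<in> carrier G \<Longrightarrow>
           \<beta> (wedge (abelianization G) (derived_subgroup G #> g) (derived_subgroup G #> h))
             = commutator G g h"
proof -
  let ?D = "derived_subgroup G" and ?C = "derived_group G" and ?A = "abelianization G"
  let ?F = "free_Abelian_group (carrier ?A \<times> carrier ?A)"
  interpret D: normal ?D G by (rule derived_self_is_normal)
  have Cgrp: "group ?C" by (rule subgroup_imp_group[OF D.subgroup_axioms])
  interpret C: comm_group ?C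
  proof (rule group.group_comm_groupI[OF Cgrp])
    fix x y assume "x \<in> carrier ?C" "y \<in> carrier ?C"
    then show "x \<otimes>\<^bsub>?C\<^esub> y = y \<otimes>\<^bsub>?C\<^esub> x"
      using derived_central[OF nil, of x y] D.mem_carrier[of y] by simp
  qed
  interpret F: comm_group ?F by (rule abelian_free_Abelian_group)
  have A: "carrier ?A = (\<lambda>g. ?D #> g) ` carrier G" by (rule carrier_FactGroup)
  define r where "r a = (SOME g. g \<in> carrier G \<and> ?D #> g = a)" for a
  have r: "r a \<in> carrier G \<and> ?D #> r a = a" if "a \<in> carrier ?A" for a
    unfolding r_def by (rule someI_ex) (use that A in auto)
  define f where "f = (\<lambda>(a, b). commutator G (r a) (r b))"
  have f: "f (?D #> g, ?D #> h) = commutator G g h" if gh [simp]: "g \<in> carrier G" "h \<in> carrier G" for g h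
  proof -
    have rep: "\<exists>c\<in>?D. r (?D #> x) = c \<otimes> x" if x: "x \<in> carrier G" for x
    proof -
      have "?D #> x \<in> carrier ?A" using x A by blast
      then have "r (?D #> x) \<in> ?D #> r (?D #> x)" and "?D #> r (?D #> x) = ?D #> x"
        using r rcos_self[OF _ D.subgroup_axioms] by blast+
      then show ?thesis by (auto simp: r_coset_def)
    qed
    obtain c where c: "c \<in> ?D" "r (?D #> g) = c \<otimes> g" using rep[OF gh(1)] by blast
    obtain d where d: "d \<in> ?D" "r (?D #> h) = d \<otimes> h" using rep[OF gh(2)] by blast
    have [simp]: "c \<in> carrier G" "d \<in> carrier G" using D.mem_carrier c(1) d(1) by blast+
    show ?thesis
      using c d by (simp add: f_def commutator_mult_class2[OF nil] commutator_derived_left[OF nil])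
  qed
  have fim: "f ` (carrier ?A \<times> carrier ?A) \<subseteq> carrier ?C"
    by (auto simp: f_def commutator_derived r)
  obtain \<phi> where \<phi>: "\<phi> \<in> hom ?F ?C"
    "\<And>p. p \<in> carrier ?A \<times> carrier ?A \<Longrightarrow> \<phi> (frag_of p) = f p"
    using C.free_Abelian_group_universal[OF fim] by blast
  interpret \<phi>: group_hom ?F ?C \<phi>
    by (simp add: group_hom_def group_hom_axioms_def \<phi> Cgrp F.is_group)
  let ?K = "kernel ?F ?C \<phi>"
  have diff: "\<phi> (u - v - w) = \<one>"
    if "u \<in> carrier ?F" "v \<in> carrier ?F" "w \<in> carrier ?F" "\<phi> u = \<phi> v \<otimes> \<phi> w" for u v w
    using C.free_hom_diff[OF \<phi>(1) that(1-3)] that(4) by simp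
  have mult: "(?D #> x) \<otimes>\<^bsub>?A\<^esub> (?D #> y) = ?D #> (x \<otimes> y)" if "x \<in> carrier G" "y \<in> carrier G" for x y
    using that by (simp add: D.rcos_sum)
  have mem: "?D #> x \<in> carrier ?A" if "x \<in> carrier G" for x using that A by blast
  have rel: "\<phi> k = \<one> \<and> k \<in> carrier ?F"
    if k: "k \<in> bilinear_relations ?A \<union> alternating_relations ?A" for k
  proof -
    have keys3: "frag_of p - frag_of q - frag_of s \<in> carrier ?F"
      if "p \<in> carrier ?A \<times> carrier ?A" "q \<in> carrier ?A \<times> carrier ?A" "s \<in> carrier ?A \<times> carrier ?A"
      for p q s :: "'a set \<times> 'a set"
    proof -
      have "Poly_Mapping.keys (frag_of p - frag_of q - frag_of s) \<subseteq> {p} \<union> {q} \<union> {s}"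
        using keys_diff[of "frag_of p - frag_of q" "frag_of s"] keys_diff[of "frag_of p" "frag_of q"]
        by auto
      then show ?thesis using that by auto
    qed
    have ex: "\<exists>x. x \<in> carrier G \<and> a = ?D #> x" if "a \<in> carrier ?A" for a
      using that A by blast
    consider (1) a a' b where "a \<in> carrier ?A" "a' \<in> carrier ?A" "b \<in> carrier ?A"
        "k = frag_of (a \<otimes>\<^bsub>?A\<^esub> a', b) - frag_of (a, b) - frag_of (a', b)"
      | (2) a b b' where "a \<in> carrier ?A" "b \<in> carrier ?A" "b' \<in> carrier ?A"
        "k = frag_of (a, b \<otimes>\<^bsub>?A\<^esub> b') - frag_of (a, b) - frag_of (a, b')"
      | (3) a where "a \<in> carrier ?A" "k = frag_of (a, a)"
      using k unfolding bilinear_relations_def alternating_relations_def by blast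
    then show ?thesis
    proof cases
      case 1
      then obtain x x' y where "x \<in> carrier G" "x' \<in> carrier G" "y \<in> carrier G"
        and "a = ?D #> x" "a' = ?D #> x'" "b = ?D #> y" using ex by meson
      with 1 mult show ?thesis
        by (auto simp del: carrier_free_Abelian_group_iff mult_FactGroup
          intro!: diff keys3 mem simp: \<phi>(2) mem f commutator_mult_class2[OF nil])
    next
      case 2
      then obtain x y y' where "x \<in> carrier G" "y \<in> carrier G" "y' \<in> carrier G"
        and "a = ?D #> x" "b = ?D #> y" "b' = ?D #> y'" using ex by meson
      with 2 mult show ?thesis
        by (auto simp del: carrier_free_Abelian_group_iff mult_FactGroup
          intro!: diff keys3 mem simp: \<phi>(2) mem f commutator_mult_class2[OF nil])
    next
      case 3
      then obtain x where "x \<in> carrier G" "a = ?D #> x" using ex by meson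
      with 3 show ?thesis by (simp add: \<phi>(2) mem f)
    qed
  qed
  let ?E = "exterior_kernel ?A"
  have E: "subgroup ?E ?F"
    unfolding exterior_kernel_def by (rule F.generate_is_subgroup) (use rel in blast)
  have EK: "?E \<subseteq> ?K"
    unfolding exterior_kernel_def
    by (rule F.generate_subgroup_incl[OF _ \<phi>.subgroup_kernel]) (use rel in \<open>auto simp: kernel_def\<close>)
  have EN: "?E \<lhd> ?F" using E by (simp add: F.normal_iff_subgroup)
  have eq: "\<phi> x = \<phi> y" if "x \<in> carrier ?F" "y \<in> carrier ?F" "?E #>\<^bsub>?F\<^esub> x = ?E #>\<^bsub>?F\<^esub> y" for x y
  proof -
    have "x \<in> ?E #>\<^bsub>?F\<^esub> y" using that F.rcos_self[OF that(1) E] by simp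
    then obtain e where e: "e \<in> ?E" "x = e \<otimes>\<^bsub>?F\<^esub> y" unfolding r_coset_def by blast
    then have "e \<in> carrier ?F" "\<phi> e = \<one>\<^bsub>?C\<^esub>" using EK by (auto simp: kernel_def)
    then have "\<phi> (e \<otimes>\<^bsub>?F\<^esub> y) = \<one>\<^bsub>?C\<^esub> \<otimes>\<^bsub>?C\<^esub> \<phi> y"
      using \<phi>.hom_mult[of e y] that(2) by simp
    then show ?thesis using e(2) that(2) \<phi>.hom_closed C.l_one by presburger
  qed
  obtain \<beta> where \<beta>: "\<beta> \<in> hom (?F Mod ?E) ?C" "\<And>x. x \<in> carrier ?F \<Longrightarrow> \<beta> (?E #>\<^bsub>?F\<^esub> x) = \<phi> x"
    using FactGroup_universal[OF \<phi>(1) EN eq] by blast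
  have val: "\<beta> (wedge ?A (?D #> g) (?D #> h)) = commutator G g h"
    if "g \<in> carrier G" "h \<in> carrier G" for g h
    using that mem[of g] mem[of h] by (simp add: wedge_def \<beta>(2) \<phi>(2) f)
  interpret \<beta>: group_hom "exterior_square ?A" ?C \<beta>
    by (simp add: group_hom_def group_hom_axioms_def exterior_square_def \<beta> Cgrp
        normal.factorgroup_is_group[OF EN])
  have wedge_mem: "wedge ?A a b \<in> carrier (exterior_square ?A)" if "a \<in> carrier ?A" "b \<in> carrier ?A" for a b
    using that unfolding wedge_def exterior_square_def carrier_FactGroup by (intro imageI) simp
  have "generate G (derived_set G (carrier G)) \<subseteq> \<beta> ` carrier (exterior_square ?A)"
  proof (rule generate_subgroup_incl)
    show "derived_set G (carrier G) \<subseteq> \<beta> ` carrier (exterior_square ?A)"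
    proof clarify
      fix g h assume gh: "g \<in> carrier G" "h \<in> carrier G"
      then have "commutator G g h \<in> \<beta> ` carrier (exterior_square ?A)"
        using val[OF gh] wedge_mem[OF mem mem] by (metis imageI)
      then show "g \<otimes> h \<otimes> inv g \<otimes> inv h \<in> \<beta> ` carrier (exterior_square ?A)"
        by (simp add: commutator_def)
    qed
    have "subgroup (\<beta> ` carrier (exterior_square ?A)) ?C" by (rule \<beta>.img_is_subgroup)
    then show "subgroup (\<beta> ` carrier (exterior_square ?A)) G"
      using incl_subgroup[OF D.subgroup_axioms] by blast
  qed
  then have "?D \<subseteq> \<beta> ` carrier (exterior_square ?A)"
    by (rule ord_eq_le_trans[OF derived_def])
  moreover have "\<beta> ` carrier (exterior_square ?A) \<subseteq> ?D"
    using \<beta>.hom_closed by auto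
  ultimately have "\<beta> \<in> epi (exterior_square ?A) ?C"
    using \<beta>.homh by (auto simp: epi_def)
  then show thesis using val that by blast
qed

end

end

theory Submission
  imports Defs
begin

text \<open>In class 2 the action of \<open>G\<close> on itself by conjugation factors through \<open>G/G'\<close>, which makes
  \<open>G \<and> G\<close> abelian. The commutator map \<open>\<kappa>\<close> is the composition of the surjection
  \<open>\<pi> : G \<and> G \<rightarrow> \<Lambda>\<^sup>2(G/G')\<close> with \<open>\<beta>\<close>, hence \<open>\<pi>\<close> maps \<open>M(G)\<close> onto \<open>L\<^sub>\<beta>\<close> and \<open>M\<^sub>0(G)\<close> onto
  \<open>D\<^sub>\<beta>\<close>. The kernel of \<open>\<pi>\<close> is generated by the \<open>g \<and> h\<close> with \<open>g\<close> or \<open>h\<close> in \<open>G'\<close>; as \<open>G'\<close> is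
  central, it lies in \<open>M\<^sub>0(G)\<close>, so \<open>\<pi>\<close> induces the isomorphism.\<close>

section \<open>Generators and homomorphisms\<close>

lemma (in group) subgroup_centralizer:
  assumes S: "S \<subseteq> carrier G"
  shows "subgroup {y \<in> carrier G. \<forall>x \<in> S. x \<otimes> y = y \<otimes> x} G"
proof (rule subgroupI)
  show "{y \<in> carrier G. \<forall>x \<in> S. x \<otimes> y = y \<otimes> x} \<noteq> {}"
    using S by (auto intro!: exI[of _ \<one>])
next
  fix y assume "y \<in> {y \<in> carrier G. \<forall>x \<in> S. x \<otimes> y = y \<otimes> x}"
  then have y: "y \<in> carrier G" and c: "\<And>x. x \<in> S \<Longrightarrow> x \<otimes> y = y \<otimes> x" by auto
  have "x \<otimes> inv y = inv y \<otimes> x" if "x \<in> S" for x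
  proof -
    have x: "x \<in> carrier G" using that S by blast
    have "inv y \<otimes> (x \<otimes> y) \<otimes> inv y = inv y \<otimes> (y \<otimes> x) \<otimes> inv y" by (simp add: c that)
    then show ?thesis using x y by (simp add: m_assoc l_cancel_inv)
  qed
  then show "inv y \<in> {y \<in> carrier G. \<forall>x \<in> S. x \<otimes> y = y \<otimes> x}" using y by simp
next
  fix y z assume "y \<in> {y \<in> carrier G. \<forall>x \<in> S. x \<otimes> y = y \<otimes> x}"
    and "z \<in> {y \<in> carrier G. \<forall>x \<in> S. x \<otimes> y = y \<otimes> x}"
  then have yz: "y \<in> carrier G" "z \<in> carrier G"
    and c: "\<And>x. x \<in> S \<Longrightarrow> x \<otimes> y = y \<otimes> x" "\<And>x. x \<in> S \<Longrightarrow> x \<otimes> z = z \<otimes> x" by auto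
  have "x \<otimes> (y \<otimes> z) = y \<otimes> z \<otimes> x" if "x \<in> S" for x
  proof -
    have x: "x \<in> carrier G" using that S by blast
    have "x \<otimes> (y \<otimes> z) = y \<otimes> (x \<otimes> z)"
      using x yz c(1)[OF that] by (simp flip: m_assoc)
    then show ?thesis using x yz c(2)[OF that] by (simp add: m_assoc)
  qed
  then show "y \<otimes> z \<in> {y \<in> carrier G. \<forall>x \<in> S. x \<otimes> y = y \<otimes> x}" using yz by simp
qed auto

text \<open>Two rounds with centralizers. The centralizer of \<open>S\<close> contains
  \<open>S\<close>, hence is the whole group, so the elements of \<open>S\<close> are central.
  Therefore the centralizer of the whole group contains \<open>S\<close> and is everything as
  well.\<close>

lemma (in group) comm_groupI_generators:
  assumes gen: "generate G S = carrier G"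
    and S: "S \<subseteq> carrier G"
    and comm: "\<And>x y. x \<in> S \<Longrightarrow> y \<in> S \<Longrightarrow> x \<otimes> y = y \<otimes> x"
  shows "comm_group G"
proof (rule group_comm_groupI)
  have "generate G S \<subseteq> {y \<in> carrier G. \<forall>x \<in> S. x \<otimes> y = y \<otimes> x}"
    using S comm by (intro generate_subgroup_incl subgroup_centralizer) auto
  then have *: "x \<otimes> y = y \<otimes> x" if "x \<in> S" "y \<in> carrier G" for x y
    using that gen by auto
  have "generate G S \<subseteq> {y \<in> carrier G. \<forall>x \<in> carrier G. x \<otimes> y = y \<otimes> x}"
    using S * [symmetric] by (intro generate_subgroup_incl subgroup_centralizer) auto
  then show "x \<otimes> y = y \<otimes> x" if "x \<in> carrier G" "y \<in> carrier G" for x y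
    using that gen by auto
qed

text \<open>The elements on which two homomorphisms agree form a subgroup. With
  \<open>generate_nwedge\<close> this reduces identities between maps out of
  \<open>G \<and> G\<close> to the elements \<open>g \<and> h\<close>.\<close>

lemma hom_eq_on_generators:
  assumes "group_hom G H h" "group_hom G H k"
    and gen: "generate G S = carrier G"
    and S: "S \<subseteq> carrier G"
    and eq: "\<And>s. s \<in> S \<Longrightarrow> h s = k s"
    and x: "x \<in> carrier G"
  shows "h x = k x"
proof -
  interpret h: group_hom G H h by fact
  interpret k: group_hom G H k by fact
  have "generate G S \<subseteq> {x \<in> carrier G. h x = k x}"
  proof (rule h.G.generate_subgroup_incl)
    show "subgroup {x \<in> carrier G. h x = k x} G"
      by (rule h.G.subgroupI) (auto intro!: exI[of _ "\<one>\<^bsub>G\<^esub>"])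
  qed (use S eq in auto)
  then show ?thesis using gen x by auto
qed

text \<open>Induction on the word, one letter at a time. Free cancellation makes the class of a
  negative letter the inverse of the class of the positive one.\<close>

lemma generate_presented_group:
  "generate (presented_group X R) ((\<lambda>x. word_class X R [(x, True)]) ` X)
     = carrier (presented_group X R)"
proof
  let ?P = "presented_group X R" and ?S = "(\<lambda>x. word_class X R [(x, True)]) ` X"
  interpret P: group ?P by (rule presented_group_is_group)
  have carr: "carrier ?P = word_class X R ` words X"
    and one: "\<one>\<^bsub>?P\<^esub> = word_class X R []"
    by (simp_all add: presented_group_def)
  show "generate ?P ?S \<subseteq> carrier ?P"
    by (rule P.generate_incl) (auto simp: carr)
  have "word_class X R u \<in> generate ?P ?S" if "u \<in> words X" for u
    using that
  proof (induction u)
    case Nil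
    show ?case using generate.one[of ?P ?S] by (simp add: one)
  next
    case (Cons l u)
    obtain x b where l: "l = (x, b)" by (cases l)
    have x: "x \<in> X" and u: "u \<in> words X" using Cons.prems l by auto
    have inv: "inv\<^bsub>?P\<^esub> (word_class X R [(x, True)]) = word_class X R [(x, False)]"
    proof (rule P.inv_equality)
      have "word_equiv X R [(x, False), (x, \<not> False)] []" by (rule word_equiv.cancel[OF x])
      then show "word_class X R [(x, False)] \<otimes>\<^bsub>?P\<^esub> word_class X R [(x, True)] = \<one>\<^bsub>?P\<^esub>"
        using x by (simp add: presented_mult one word_class_eq)
    qed (use x in \<open>auto simp: carr\<close>)
    have "word_class X R [l] \<in> generate ?P ?S"
    proof (cases b)
      case True
      then show ?thesis using x l by (auto intro: generate.incl)
    next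
      case False
      then show ?thesis using x l generate.inv[of "word_class X R [(x, True)]" ?S ?P] by (simp add: inv)
    qed
    then have "word_class X R [l] \<otimes>\<^bsub>?P\<^esub> word_class X R u \<in> generate ?P ?S"
      using Cons.IH[OF u] by (rule generate.eng)
    then show ?case using x u l by (simp add: presented_mult)
  qed
  then show "carrier ?P \<subseteq> generate ?P ?S" by (auto simp: carr)
qed

section \<open>The nonabelian exterior square\<close>

lemma nwedge_closed:
  assumes "g \<in> carrier G" "h \<in> carrier G"
  shows "nwedge G g h \<in> carrier (nonabelian_exterior_square G)"
  using assms by (auto simp: nwedge_def nonabelian_exterior_square_def presented_group_def)

lemma generate_nwedge:
  "generate (nonabelian_exterior_square G) {nwedge G g h |g h. g \<in> carrier G \<and> h \<in> carrier G}
     = carrier (nonabelian_exterior_square G)"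
proof -
  have "{nwedge G g h |g h. g \<in> carrier G \<and> h \<in> carrier G}
    = (\<lambda>x. word_class (carrier G \<times> carrier G) (exterior_relations G) [(x, True)])
        ` (carrier G \<times> carrier G)"
    unfolding nwedge_def by auto
  then show ?thesis
    unfolding nonabelian_exterior_square_def by (simp add: generate_presented_group)
qed

context group begin

lemma conjugate_closed [simp]:
  "g \<in> carrier G \<Longrightarrow> x \<in> carrier G \<Longrightarrow> conjugate G g x \<in> carrier G"
  by (simp add: conjugate_def)

lemma conjugate_mult:
  assumes "g \<in> carrier G" "x \<in> carrier G" "y \<in> carrier G"
  shows "conjugate G g (x \<otimes> y) = conjugate G g x \<otimes> conjugate G g y"
  using assms by (simp add: conjugate_def m_assoc l_cancel_inv)

lemma conjugate_conjugate:
  assumes "g \<in> carrier G" "h \<in> carrier G" "x \<in> carrier G"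
  shows "conjugate G g (conjugate G h x) = conjugate G (g \<otimes> h) x"
  using assms by (simp add: conjugate_def m_assoc inv_mult_group)

lemma conjugate_inv_cancel:
  assumes "g \<in> carrier G" "x \<in> carrier G"
  shows "conjugate G g (conjugate G (inv g) x) = x"
  using assms by (simp add: conjugate_conjugate) (simp add: conjugate_def)

text \<open>This and the next two lemmas carry the Brown-Loday relations from words over to
  equations in \<open>G \<and> G\<close>, where group arithmetic is available.\<close>

lemma nwedge_mult_left:
  assumes [simp]: "g \<in> carrier G" "g' \<in> carrier G" "h \<in> carrier G"
  shows "nwedge G (g \<otimes> g') h = nwedge G (conjugate G g g') (conjugate G g h)
           \<otimes>\<^bsub>nonabelian_exterior_square G\<^esub> nwedge G g h"
proof -
  have "word_equiv (carrier G \<times> carrier G) (exterior_relations G) [((g \<otimes> g', h), True)]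
      [((conjugate G g g', conjugate G g h), True), ((g, h), True)]"
    by (rule word_equiv.relation) (auto simp: exterior_relations_def intro: assms)
  then show ?thesis
    by (simp add: nwedge_def nonabelian_exterior_square_def presented_mult word_class_eq)
qed

lemma nwedge_mult_right:
  assumes [simp]: "g \<in> carrier G" "h \<in> carrier G" "h' \<in> carrier G"
  shows "nwedge G g (h \<otimes> h') = nwedge G g h
           \<otimes>\<^bsub>nonabelian_exterior_square G\<^esub> nwedge G (conjugate G h g) (conjugate G h h')"
proof -
  have "word_equiv (carrier G \<times> carrier G) (exterior_relations G) [((g, h \<otimes> h'), True)]
      [((g, h), True), ((conjugate G h g, conjugate G h h'), True)]"
    by (rule word_equiv.relation) (auto simp: exterior_relations_def intro: assms)
  then show ?thesis
    by (simp add: nwedge_def nonabelian_exterior_square_def presented_mult word_class_eq)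
qed

lemma nwedge_self:
  assumes [simp]: "g \<in> carrier G"
  shows "nwedge G g g = \<one>\<^bsub>nonabelian_exterior_square G\<^esub>"
proof -
  have "word_equiv (carrier G \<times> carrier G) (exterior_relations G) [((g, g), True)] []"
    by (rule word_equiv.relation) (auto simp: exterior_relations_def intro: assms)
  then show ?thesis
    by (simp add: nwedge_def nonabelian_exterior_square_def word_class_eq)
      (simp add: presented_group_def)
qed

text \<open>Compare the two expansions of \<open>gg' \<and> hh'\<close>.\<close>

lemma nwedge_exchange:
  assumes [simp]: "g \<in> carrier G" "g' \<in> carrier G" "h \<in> carrier G" "h' \<in> carrier G"
  defines "E \<equiv> nonabelian_exterior_square G"
  shows "nwedge G (conjugate G (g \<otimes> h) g') (conjugate G (g \<otimes> h) h') \<otimes>\<^bsub>E\<^esub> nwedge G g h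
       = nwedge G g h \<otimes>\<^bsub>E\<^esub> nwedge G (conjugate G (h \<otimes> g) g') (conjugate G (h \<otimes> g) h')"
proof -
  interpret E: group E unfolding E_def by (rule nonabelian_exterior_square_is_group)
  note closed [simp] = nwedge_closed[of _ G, folded E_def]
  let ?a = "nwedge G (conjugate G g g') (conjugate G g h)"
  let ?b = "nwedge G (conjugate G h g) (conjugate G h h')"
  let ?c = "nwedge G (conjugate G (g \<otimes> h) g') (conjugate G (g \<otimes> h) h')"
  let ?d = "nwedge G (conjugate G (h \<otimes> g) g') (conjugate G (h \<otimes> g) h')"
  \<comment> \<open>Expanding twice produces nested conjugations. They simplify because the
    conjugate of \<open>h\<close> by \<open>g\<close>, times \<open>g\<close>, is
    \<open>g \<otimes> h\<close>, and likewise with \<open>g\<close> and \<open>h\<close>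
    exchanged.\<close>
  have conj: "conjugate G (conjugate G g h) (conjugate G g x) = conjugate G (g \<otimes> h) x"
    "conjugate G (conjugate G h g) (conjugate G h x) = conjugate G (h \<otimes> g) x"
    if "x \<in> carrier G" for x
    using that by (simp_all add: conjugate_def m_assoc inv_mult_group l_cancel_inv)
  have "nwedge G (g \<otimes> g') (h \<otimes> h')
      = nwedge G (conjugate G g g') (conjugate G g (h \<otimes> h')) \<otimes>\<^bsub>E\<^esub> nwedge G g (h \<otimes> h')"
    unfolding E_def by (rule nwedge_mult_left) simp_all
  moreover have "\<dots> = ?a \<otimes>\<^bsub>E\<^esub> ?c \<otimes>\<^bsub>E\<^esub> (nwedge G g h \<otimes>\<^bsub>E\<^esub> ?b)"
    by (simp add: nwedge_mult_right conjugate_mult conj flip: E_def)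
  moreover have "nwedge G (g \<otimes> g') (h \<otimes> h')
      = nwedge G (g \<otimes> g') h \<otimes>\<^bsub>E\<^esub> nwedge G (conjugate G h (g \<otimes> g')) (conjugate G h h')"
    unfolding E_def by (rule nwedge_mult_right) simp_all
  moreover have "\<dots> = ?a \<otimes>\<^bsub>E\<^esub> nwedge G g h \<otimes>\<^bsub>E\<^esub> (?d \<otimes>\<^bsub>E\<^esub> ?b)"
    by (simp add: nwedge_mult_left conjugate_mult conj flip: E_def)
  ultimately have "?a \<otimes>\<^bsub>E\<^esub> (?c \<otimes>\<^bsub>E\<^esub> nwedge G g h \<otimes>\<^bsub>E\<^esub> ?b)
      = ?a \<otimes>\<^bsub>E\<^esub> (nwedge G g h \<otimes>\<^bsub>E\<^esub> ?d \<otimes>\<^bsub>E\<^esub> ?b)"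
    by (simp add: E.m_assoc)
  then show ?thesis by simp
qed

section \<open>Commutativity of \<open>G \<and> G\<close> in class 2\<close>

lemma conjugate_eq_commutator:
  assumes "g \<in> carrier G" "x \<in> carrier G"
  shows "conjugate G g x = commutator G g x \<otimes> x"
  using assms by (simp add: conjugate_def commutator_def m_assoc)

text \<open>Conjugation by \<open>g\<close> multiplies \<open>x\<close> by \<open>[g, x]\<close>. By
  bilinearity, conjugation by \<open>g \<otimes> h\<close> multiplies \<open>x\<close> by
  \<open>[g, x]\<close> and \<open>[h, x]\<close>, whose order does not matter as both are
  central.\<close>

lemma conjugate_mult_commute_class2:
  assumes nil: "nilpotent_of_class G 2"
    and [simp]: "g \<in> carrier G" "h \<in> carrier G" "x \<in> carrier G"
  shows "conjugate G (g \<otimes> h) x = conjugate G (h \<otimes> g) x"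
  using derived_central[OF nil commutator_derived[of g x], of "commutator G h x"]
  by (simp add: conjugate_eq_commutator commutator_mult_class2[OF nil])

text \<open>In \<open>nwedge_exchange\<close> the wedge moved past \<open>g \<and> h\<close> changes
  only from a conjugate by \<open>g \<otimes> h\<close> to one by \<open>h \<otimes> g\<close>. In
  class 2 these agree, so the generators commute.\<close>

lemma comm_group_exterior_square_class2:
  assumes nil: "nilpotent_of_class G 2"
  shows "comm_group (nonabelian_exterior_square G)"
proof (rule group.comm_groupI_generators[OF nonabelian_exterior_square_is_group generate_nwedge])
  let ?E = "nonabelian_exterior_square G"
  have "nwedge G x y \<otimes>\<^bsub>?E\<^esub> nwedge G g h = nwedge G g h \<otimes>\<^bsub>?E\<^esub> nwedge G x y"
    if [simp]: "x \<in> carrier G" "y \<in> carrier G" "g \<in> carrier G" "h \<in> carrier G" for x y g h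
  proof -
    \<comment> \<open>Every element is a conjugate by \<open>g \<otimes> h\<close>, so
      \<open>x\<close> and \<open>y\<close> are put in the form required by
      \<open>nwedge_exchange\<close>.\<close>
    have "conjugate G (h \<otimes> g) (conjugate G (inv (g \<otimes> h)) z) = z" if [simp]: "z \<in> carrier G" for z
      using conjugate_mult_commute_class2[OF nil, of h g "conjugate G (inv (g \<otimes> h)) z"]
      by (simp add: conjugate_inv_cancel)
    then show ?thesis
      using nwedge_exchange[of g "conjugate G (inv (g \<otimes> h)) x" h "conjugate G (inv (g \<otimes> h)) y"]
      by (simp add: conjugate_inv_cancel)
  qed
  then show "U \<otimes>\<^bsub>?E\<^esub> V = V \<otimes>\<^bsub>?E\<^esub> U"
    if "U \<in> {nwedge G g h |g h. g \<in> carrier G \<and> h \<in> carrier G}"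
      and "V \<in> {nwedge G g h |g h. g \<in> carrier G \<and> h \<in> carrier G}" for U V
    using that by blast
qed (auto simp: nwedge_closed)

end

section \<open>The exterior square of an abelian group\<close>

lemma frag_of_diff_diff_closed:
  assumes "p \<in> S" "q \<in> S" "r \<in> S"
  shows "frag_of p - frag_of q - frag_of r \<in> carrier (free_Abelian_group S)"
proof -
  have "Poly_Mapping.keys (frag_of p - frag_of q - frag_of r) \<subseteq> {p} \<union> {q} \<union> {r}"
    using keys_diff[of "frag_of p - frag_of q" "frag_of r"] keys_diff[of "frag_of p" "frag_of q"]
    by auto
  then show ?thesis using assms by auto
qed

lemma bilinear_alternating_closed:
  assumes "monoid A"
  shows "bilinear_relations A \<union> alternating_relations A
           \<subseteq> carrier (free_Abelian_group (carrier A \<times> carrier A))"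
  unfolding bilinear_relations_def alternating_relations_def
  by (auto simp del: carrier_free_Abelian_group_iff intro!: frag_of_diff_diff_closed
      simp: monoid.m_closed[OF assms])

lemma exterior_kernel_normal:
  assumes "monoid A"
  shows "exterior_kernel A \<lhd> free_Abelian_group (carrier A \<times> carrier A)"
proof -
  interpret F: comm_group "free_Abelian_group (carrier A \<times> carrier A)"
    by (rule abelian_free_Abelian_group)
  show ?thesis
    unfolding exterior_kernel_def F.normal_iff_subgroup
    by (rule F.generate_is_subgroup[OF bilinear_alternating_closed[OF assms]])
qed

lemma comm_group_exterior_square:
  assumes "monoid A"
  shows "comm_group (exterior_square A)"
  unfolding exterior_square_def
  by (rule comm_group.abelian_FactGroup[OF abelian_free_Abelian_group])
    (rule normal_imp_subgroup[OF exterior_kernel_normal[OF assms]])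

lemma wedge_closed:
  assumes "a \<in> carrier A" "b \<in> carrier A"
  shows "wedge A a b \<in> carrier (exterior_square A)"
  using assms unfolding wedge_def exterior_square_def carrier_FactGroup by (intro imageI) simp

text \<open>Stated for pairs so that it serves linearity in both arguments. A bilinear relation lies
  in the subgroup divided out, which puts \<open>frag_of p\<close> into the coset of the sum of
  \<open>frag_of q\<close> and \<open>frag_of r\<close>.\<close>

lemma wedge_eq_mult:
  assumes A: "monoid A"
    and "p \<in> carrier A \<times> carrier A" "q \<in> carrier A \<times> carrier A" "r \<in> carrier A \<times> carrier A"
    and rel: "frag_of p - frag_of q - frag_of r \<in> bilinear_relations A"
  shows "case_prod (wedge A) p = case_prod (wedge A) q \<otimes>\<^bsub>exterior_square A\<^esub> case_prod (wedge A) r"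
proof -
  let ?F = "free_Abelian_group (carrier A \<times> carrier A)" and ?N = "exterior_kernel A"
  interpret N: normal ?N ?F by (rule exterior_kernel_normal[OF A])
  have "frag_of p - frag_of q - frag_of r \<in> ?N"
    unfolding exterior_kernel_def using rel by (blast intro: generate.incl)
  then have "frag_of p \<in> ?N #>\<^bsub>?F\<^esub> (frag_of q \<otimes>\<^bsub>?F\<^esub> frag_of r)"
    unfolding r_coset_def by (auto intro!: bexI[of _ "frag_of p - frag_of q - frag_of r"])
  moreover have qr: "frag_of q \<in> carrier ?F" "frag_of r \<in> carrier ?F"
    using assms by (simp_all del: carrier_free_Abelian_group_iff)
  ultimately have "?N #>\<^bsub>?F\<^esub> frag_of p = ?N #>\<^bsub>?F\<^esub> (frag_of q \<otimes>\<^bsub>?F\<^esub> frag_of r)"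
    using N.repr_independence[OF _ N.m_closed[OF qr] N.subgroup_axioms] by metis
  then show ?thesis
    using N.rcos_sum[OF qr] by (auto simp: wedge_def exterior_square_def split: prod.splits)
qed

lemma wedge_mult_left:
  assumes "monoid A" "a \<in> carrier A" "a' \<in> carrier A" "b \<in> carrier A"
  shows "wedge A (a \<otimes>\<^bsub>A\<^esub> a') b = wedge A a b \<otimes>\<^bsub>exterior_square A\<^esub> wedge A a' b"
proof -
  have "frag_of (a \<otimes>\<^bsub>A\<^esub> a', b) - frag_of (a, b) - frag_of (a', b) \<in> bilinear_relations A"
    unfolding bilinear_relations_def using assms by blast
  then show ?thesis
    using wedge_eq_mult[of A "(a \<otimes>\<^bsub>A\<^esub> a', b)" "(a, b)" "(a', b)"] assms
    by (simp add: monoid.m_closed)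
qed

lemma wedge_mult_right:
  assumes "monoid A" "a \<in> carrier A" "b \<in> carrier A" "b' \<in> carrier A"
  shows "wedge A a (b \<otimes>\<^bsub>A\<^esub> b') = wedge A a b \<otimes>\<^bsub>exterior_square A\<^esub> wedge A a b'"
proof -
  have "frag_of (a, b \<otimes>\<^bsub>A\<^esub> b') - frag_of (a, b) - frag_of (a, b') \<in> bilinear_relations A"
    unfolding bilinear_relations_def using assms by blast
  then show ?thesis
    using wedge_eq_mult[of A "(a, b \<otimes>\<^bsub>A\<^esub> b')" "(a, b)" "(a, b')"] assms
    by (simp add: monoid.m_closed)
qed

lemma wedge_self:
  assumes "monoid A" "a \<in> carrier A"
  shows "wedge A a a = \<one>\<^bsub>exterior_square A\<^esub>"
proof -
  let ?F = "free_Abelian_group (carrier A \<times> carrier A)" and ?N = "exterior_kernel A"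
  interpret N: normal ?N ?F by (rule exterior_kernel_normal[OF assms(1)])
  have "frag_of (a, a) \<in> ?N"
    unfolding exterior_kernel_def alternating_relations_def using assms(2)
    by (blast intro: generate.incl)
  then show ?thesis by (simp add: wedge_def exterior_square_def N.rcos_const)
qed

text \<open>The free abelian group is reached from the elements \<open>frag_of p\<close> by
  differences. The projection sends these elements to wedges and differences to quotients in the
  exterior square.\<close>

lemma generate_wedge:
  assumes A: "monoid A"
  shows "generate (exterior_square A) {wedge A a b |a b. a \<in> carrier A \<and> b \<in> carrier A}
           = carrier (exterior_square A)"
proof
  let ?F = "free_Abelian_group (carrier A \<times> carrier A)" and ?N = "exterior_kernel A"
  let ?W = "{wedge A a b |a b. a \<in> carrier A \<and> b \<in> carrier A}"
  interpret N: normal ?N ?F by (rule exterior_kernel_normal[OF A])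
  interpret L: comm_group "exterior_square A" by (rule comm_group_exterior_square[OF A])
  have W: "?W \<subseteq> carrier (exterior_square A)" by (auto simp: wedge_closed)
  then show "generate (exterior_square A) ?W \<subseteq> carrier (exterior_square A)"
    by (rule L.generate_incl)
  interpret gen: subgroup "generate (exterior_square A) ?W" "exterior_square A"
    by (rule L.generate_is_subgroup[OF W])
  interpret q: group_hom ?F "exterior_square A" "\<lambda>x. ?N #>\<^bsub>?F\<^esub> x"
    using N.r_coset_hom_Mod L.is_group N.is_group
    by (simp add: group_hom_def group_hom_axioms_def exterior_square_def)
  have "?N #>\<^bsub>?F\<^esub> x \<in> generate (exterior_square A) ?W"
    if "x \<in> carrier ?F" for x
  proof (rule free_Abelian_group_induct[of x "carrier A \<times> carrier A"])
    show "Poly_Mapping.keys x \<subseteq> carrier A \<times> carrier A" using that by simp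
  next
    show "?N #>\<^bsub>?F\<^esub> 0 \<in> generate (exterior_square A) ?W"
      using gen.one_closed q.hom_one by simp
  next
    fix x y :: "'a \<times> 'a \<Rightarrow>\<^sub>0 int"
    assume xy: "Poly_Mapping.keys x \<subseteq> carrier A \<times> carrier A"
      "Poly_Mapping.keys y \<subseteq> carrier A \<times> carrier A"
      and "?N #>\<^bsub>?F\<^esub> x \<in> generate (exterior_square A) ?W"
        "?N #>\<^bsub>?F\<^esub> y \<in> generate (exterior_square A) ?W"
    then have "(?N #>\<^bsub>?F\<^esub> x) \<otimes>\<^bsub>exterior_square A\<^esub> inv\<^bsub>exterior_square A\<^esub> (?N #>\<^bsub>?F\<^esub> y)
        \<in> generate (exterior_square A) ?W" by blast
    moreover have "?N #>\<^bsub>?F\<^esub> (x - y)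
        = (?N #>\<^bsub>?F\<^esub> x) \<otimes>\<^bsub>exterior_square A\<^esub> inv\<^bsub>exterior_square A\<^esub> (?N #>\<^bsub>?F\<^esub> y)"
      using q.hom_mult[of x "inv\<^bsub>?F\<^esub> y"] q.hom_inv[of y] xy by simp
    ultimately show "?N #>\<^bsub>?F\<^esub> (x - y) \<in> generate (exterior_square A) ?W" by simp
  next
    fix p assume "p \<in> carrier A \<times> carrier A"
    then show "?N #>\<^bsub>?F\<^esub> frag_of p \<in> generate (exterior_square A) ?W"
      by (intro generate.incl) (auto simp: wedge_def)
  qed
  then show "carrier (exterior_square A) \<subseteq> generate (exterior_square A) ?W"
    by (auto simp: exterior_square_def carrier_FactGroup)
qed

text \<open>An alternating bilinear map extends linearly to the free abelian group on pairs, kills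
  the relations, and so factors through the quotient. It later provides a map from the exterior
  square of \<open>G/G'\<close> back to \<open>G \<and> G\<close> modulo M_0(G).\<close>

lemma (in comm_group) exterior_square_universal:
  assumes A: "monoid A"
    and closed: "\<And>a b. a \<in> carrier A \<Longrightarrow> b \<in> carrier A \<Longrightarrow> f a b \<in> carrier G"
    and left: "\<And>a a' b. a \<in> carrier A \<Longrightarrow> a' \<in> carrier A \<Longrightarrow> b \<in> carrier A \<Longrightarrow>
      f (a \<otimes>\<^bsub>A\<^esub> a') b = f a b \<otimes> f a' b"
    and right: "\<And>a b b'. a \<in> carrier A \<Longrightarrow> b \<in> carrier A \<Longrightarrow> b' \<in> carrier A \<Longrightarrow>
      f a (b \<otimes>\<^bsub>A\<^esub> b') = f a b \<otimes> f a b'"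
    and self: "\<And>a. a \<in> carrier A \<Longrightarrow> f a a = \<one>"
  obtains \<sigma> where "\<sigma> \<in> hom (exterior_square A) G"
    and "\<And>a b. a \<in> carrier A \<Longrightarrow> b \<in> carrier A \<Longrightarrow> \<sigma> (wedge A a b) = f a b"
proof -
  let ?S = "carrier A \<times> carrier A"
  let ?F = "free_Abelian_group ?S" and ?N = "exterior_kernel A"
  interpret F: comm_group ?F by (rule abelian_free_Abelian_group)
  have "case_prod f ` ?S \<subseteq> carrier G" using closed by auto
  then obtain \<phi> where \<phi>: "\<phi> \<in> hom ?F G"
    and val: "\<And>p. p \<in> ?S \<Longrightarrow> \<phi> (frag_of p) = case_prod f p"
    using free_Abelian_group_universal[of "case_prod f" ?S] by blast
  interpret \<phi>: group_hom ?F G \<phi>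
    by (simp add: group_hom_def group_hom_axioms_def \<phi> F.is_group)
  have diff: "\<phi> (frag_of p - frag_of q - frag_of r) = \<one>"
    if "p \<in> ?S" "q \<in> ?S" "r \<in> ?S" "case_prod f p = case_prod f q \<otimes> case_prod f r" for p q r
    by (rule free_hom_diff[OF \<phi>])
      (use that val in \<open>simp_all del: carrier_free_Abelian_group_iff\<close>)
  have "\<phi> x = \<one>" if "x \<in> bilinear_relations A \<union> alternating_relations A" for x
    using that unfolding bilinear_relations_def alternating_relations_def
    by (auto simp: val left right self monoid.m_closed[OF A] intro!: diff)
  then have "bilinear_relations A \<union> alternating_relations A \<subseteq> kernel ?F G \<phi>"
    using bilinear_alternating_closed[OF A] unfolding kernel_def by blast
  then have "?N \<subseteq> kernel ?F G \<phi>"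
    unfolding exterior_kernel_def by (rule F.generate_subgroup_incl[OF _ \<phi>.subgroup_kernel])
  then obtain \<sigma> where \<sigma>: "\<sigma> \<in> hom (?F Mod ?N) G"
    "\<And>x. x \<in> carrier ?F \<Longrightarrow> \<sigma> (?N #>\<^bsub>?F\<^esub> x) = \<phi> x"
    using \<phi>.FactGroup_universal_kernel[OF exterior_kernel_normal[OF A]] by metis
  show thesis
  proof
    show "\<sigma> \<in> hom (exterior_square A) G" using \<sigma>(1) by (simp add: exterior_square_def)
    show "\<sigma> (wedge A a b) = f a b" if "a \<in> carrier A" "b \<in> carrier A" for a b
      using that by (simp add: wedge_def \<sigma>(2) val)
  qed
qed

section \<open>Passing from the nonabelian to the abelian exterior square\<close>

context group begin

lemma coset_in_abelianization:
  "g \<in> carrier G \<Longrightarrow> derived_subgroup G #> g \<in> carrier (abelianization G)"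
  by (auto simp: carrier_FactGroup)

lemma abelianization_cases:
  assumes "a \<in> carrier (abelianization G)"
  obtains g where "g \<in> carrier G" "a = derived_subgroup G #> g"
  using assms by (auto simp: carrier_FactGroup)

lemma coset_mult_abelianization:
  "g \<in> carrier G \<Longrightarrow> h \<in> carrier G \<Longrightarrow>
     derived_subgroup G #> (g \<otimes> h)
       = (derived_subgroup G #> g) \<otimes>\<^bsub>abelianization G\<^esub> (derived_subgroup G #> h)"
  by (simp add: normal.rcos_sum[OF derived_self_is_normal])

lemma coset_conjugate:
  assumes [simp]: "g \<in> carrier G" "x \<in> carrier G"
  shows "derived_subgroup G #> conjugate G g x = derived_subgroup G #> x"
proof -
  interpret D: normal "derived_subgroup G" G by (rule derived_self_is_normal)
  have "conjugate G g x \<in> derived_subgroup G #> x"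
    using commutator_derived[of g x] by (auto simp: conjugate_eq_commutator r_coset_def)
  then show ?thesis using repr_independence[OF _ _ D.subgroup_axioms] by simp
qed

text \<open>Conjugation is invisible modulo \<open>G'\<close>, so the Brown-Loday relations become
  bilinearity and alternation there. The order of factors in the first relation is harmless because
  the target is abelian.\<close>

lemma exterior_square_abelianization_exists:
  obtains \<pi> where
    "group_hom (nonabelian_exterior_square G) (exterior_square (abelianization G)) \<pi>"
    and "\<And>g h. g \<in> carrier G \<Longrightarrow> h \<in> carrier G \<Longrightarrow> \<pi> (nwedge G g h)
           = wedge (abelianization G) (derived_subgroup G #> g) (derived_subgroup G #> h)"
proof -
  let ?A = "abelianization G" and ?D = "derived_subgroup G" and ?X = "carrier G \<times> carrier G"
  let ?L = "exterior_square ?A"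
  let ?f = "\<lambda>(g, h). wedge ?A (?D #> g) (?D #> h)"
  interpret A: comm_group ?A by (rule derived_quot_is_comm_group)
  interpret L: comm_group ?L by (rule comm_group_exterior_square[OF A.is_monoid])
  note [simp] = wedge_closed[of _ ?A] coset_in_abelianization coset_conjugate
  have f: "?f ` ?X \<subseteq> carrier ?L" by auto
  have R: "word_eval ?L ?f u = word_eval ?L ?f v" if "(u, v) \<in> exterior_relations G" for u v
    using that unfolding exterior_relations_def
    by (auto simp del: mult_FactGroup simp: coset_mult_abelianization wedge_mult_left[OF A.is_monoid]
        wedge_mult_right[OF A.is_monoid] wedge_self[OF A.is_monoid] L.m_comm)
  note lift = L.presented_lift_hom[of ?f ?X "exterior_relations G", OF f R]
  show thesis
  proof
    show "group_hom (nonabelian_exterior_square G) ?L (presented_lift ?L ?f)"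
      using lift(1) nonabelian_exterior_square_is_group[of G] L.is_group
      by (simp add: group_hom_def group_hom_axioms_def nonabelian_exterior_square_def)
    show "presented_lift ?L ?f (nwedge G g h) = wedge ?A (?D #> g) (?D #> h)"
      if "g \<in> carrier G" "h \<in> carrier G" for g h
      using lift(2)[of "(g, h)"] that by (simp add: nwedge_def nonabelian_exterior_square_def)
  qed
qed

section \<open>M_0(G) contains the kernel of \<pi>\<close>

lemma subgroup_schur_multiplier_0:
  "subgroup (schur_multiplier_0 G) (nonabelian_exterior_square G)"
  unfolding schur_multiplier_0_def
  by (rule group.generate_is_subgroup[OF nonabelian_exterior_square_is_group])
    (auto simp: nwedge_closed)

text \<open>As \<open>c\<close> is central, \<open>c\<close> and \<open>g\<close> commute, so both
  wedges are among the generators of M_0(G).\<close>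

lemma nwedge_derived_in_schur_multiplier_0:
  assumes "nilpotent_of_class G 2" "c \<in> derived_subgroup G" "g \<in> carrier G"
  shows "nwedge G c g \<in> schur_multiplier_0 G" "nwedge G g c \<in> schur_multiplier_0 G"
proof -
  have "c \<in> carrier G" using assms(2) derived_in_carrier by blast
  then show "nwedge G c g \<in> schur_multiplier_0 G" "nwedge G g c \<in> schur_multiplier_0 G"
    unfolding schur_multiplier_0_def
    using assms commutator_derived_left[OF assms] by (blast intro: generate.incl)+
qed

text \<open>Modulo the commuting wedges, \<open>g \<and> h\<close> depends only on the cosets \<open>gG'\<close> and \<open>hG'\<close> and is
  bilinear in them, so that \<open>G \<and> G\<close> modulo these wedges is a quotient of \<open>\<Lambda>\<^sup>2(G/G')\<close>.\<close>

lemma kernel_subset_schur_multiplier_0: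
  assumes nil: "nilpotent_of_class G 2"
    and \<pi>: "group_hom (nonabelian_exterior_square G) (exterior_square (abelianization G)) \<pi>"
    and \<pi>_nwedge: "\<And>g h. g \<in> carrier G \<Longrightarrow> h \<in> carrier G \<Longrightarrow> \<pi> (nwedge G g h)
           = wedge (abelianization G) (derived_subgroup G #> g) (derived_subgroup G #> h)"
  shows "kernel (nonabelian_exterior_square G) (exterior_square (abelianization G)) \<pi>
           \<subseteq> schur_multiplier_0 G"
proof -
  let ?E = "nonabelian_exterior_square G" and ?A = "abelianization G" and ?D = "derived_subgroup G"
  let ?N = "schur_multiplier_0 G"
  let ?Q = "?E Mod ?N"
  interpret D: normal ?D G by (rule derived_self_is_normal)
  interpret A: comm_group ?A by (rule derived_quot_is_comm_group)
  interpret E: comm_group ?E by (rule comm_group_exterior_square_class2[OF nil])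
  interpret \<pi>: group_hom ?E "exterior_square ?A" \<pi> by (rule \<pi>)
  interpret N: normal ?N ?E
    using subgroup_schur_multiplier_0 by (simp add: E.normal_iff_subgroup)
  interpret Q: comm_group ?Q by (rule E.abelian_FactGroup[OF N.subgroup_axioms])
  interpret q: group_hom ?E ?Q "\<lambda>x. ?N #>\<^bsub>?E\<^esub> x"
    using N.r_coset_hom_Mod by (simp add: group_hom_def group_hom_axioms_def)
  define k where "k g h = ?N #>\<^bsub>?E\<^esub> nwedge G g h" for g h
  note closed [simp] = nwedge_closed[of _ G]
  have k_closed [simp]: "k g h \<in> carrier ?Q" if "g \<in> carrier G" "h \<in> carrier G" for g h
    using that unfolding k_def by (intro q.hom_closed) simp
  have k_derived: "k c g = \<one>\<^bsub>?Q\<^esub>" "k g c = \<one>\<^bsub>?Q\<^esub>" if "c \<in> ?D" "g \<in> carrier G" for c g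
    using nwedge_derived_in_schur_multiplier_0[OF nil that]
    by (simp_all add: k_def N.rcos_const)
  have D_conj: "conjugate G c x = x" if "c \<in> ?D" "x \<in> carrier G" for c x
    using derived_central[OF nil that] that D.mem_carrier
    by (simp add: conjugate_def m_assoc)
  \<comment> \<open>A central \<open>c\<close> conjugates trivially, so expanding leaves only the
    extra factor \<open>k c h\<close>, which is trivial in the quotient.\<close>
  have k_left: "k (c \<otimes> g) h = k g h"
    if c: "c \<in> ?D" and [simp]: "g \<in> carrier G" "h \<in> carrier G" for c g h
  proof -
    have [simp]: "c \<in> carrier G" using c by (rule D.mem_carrier)
    have "k (c \<otimes> g) h = k g h \<otimes>\<^bsub>?Q\<^esub> k c h"
      unfolding k_def
      by (simp add: nwedge_mult_left D_conj c del: mult_FactGroup)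
    then show ?thesis using k_derived[OF c, of h] Q.r_one[of "k g h"] by simp
  qed
  have k_right: "k g (c \<otimes> h) = k g h"
    if c: "c \<in> ?D" and [simp]: "g \<in> carrier G" "h \<in> carrier G" for c g h
  proof -
    have [simp]: "c \<in> carrier G" using c by (rule D.mem_carrier)
    have "k g (c \<otimes> h) = k g c \<otimes>\<^bsub>?Q\<^esub> k g h"
      unfolding k_def
      by (simp add: nwedge_mult_right D_conj c del: mult_FactGroup)
    then show ?thesis using k_derived[OF c, of g] Q.l_one[of "k g h"] by simp
  qed
  \<comment> \<open>Conjugation by \<open>x\<close> changes each argument by a commutator, which
    \<open>k_left\<close> and \<open>k_right\<close> absorb. The twisted relations thus become
    honest bilinearity of \<open>k\<close>.\<close>
  have k_conj: "k (conjugate G x g) (conjugate G x h) = k g h"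
    if "x \<in> carrier G" "g \<in> carrier G" "h \<in> carrier G" for x g h
    using that by (simp add: conjugate_eq_commutator commutator_derived k_left k_right)
  have k_mult_left: "k (g \<otimes> g') h = k g h \<otimes>\<^bsub>?Q\<^esub> k g' h"
    if "g \<in> carrier G" "g' \<in> carrier G" "h \<in> carrier G" for g g' h
  proof -
    have "k (g \<otimes> g') h = k (conjugate G g g') (conjugate G g h) \<otimes>\<^bsub>?Q\<^esub> k g h"
      unfolding k_def using that by (simp add: nwedge_mult_left del: mult_FactGroup)
    then show ?thesis using that Q.m_comm[of "k g' h" "k g h"] k_conj[of g g' h] by simp
  qed
  have k_mult_right: "k g (h \<otimes> h') = k g h \<otimes>\<^bsub>?Q\<^esub> k g h'"
    if "g \<in> carrier G" "h \<in> carrier G" "h' \<in> carrier G" for g h h'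
  proof -
    have "k g (h \<otimes> h') = k g h \<otimes>\<^bsub>?Q\<^esub> k (conjugate G h g) (conjugate G h h')"
      unfolding k_def using that by (simp add: nwedge_mult_right del: mult_FactGroup)
    then show ?thesis using that k_conj[of h g h'] by simp
  qed
  have k_self: "k g g = \<one>\<^bsub>?Q\<^esub>" if "g \<in> carrier G" for g
    using that q.hom_one by (simp add: k_def nwedge_self)
  \<comment> \<open>A set-theoretic section of \<open>G\<close> over \<open>G/G'\<close>, used to
    turn \<open>k\<close> into a function \<open>f\<close> of cosets.\<close>
  define r where "r a = (SOME g. g \<in> carrier G \<and> ?D #> g = a)" for a
  have r: "r a \<in> carrier G \<and> ?D #> r a = a" if "a \<in> carrier ?A" for a
    unfolding r_def by (rule someI_ex) (use that abelianization_cases in metis)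
  have r_coset: "\<exists>c \<in> ?D. x = c \<otimes> r a"
    if "a \<in> carrier ?A" "x \<in> carrier G" "?D #> x = a" for a x
    using rcos_self[OF that(2) D.subgroup_axioms] r[OF that(1)] that(3)
    by (auto simp: r_coset_def)
  \<comment> \<open>Any lifts may replace the chosen ones, since they differ from them by elements
    of \<open>G'\<close>.\<close>
  have k_r: "k (r a) (r b) = k x y"
    if a: "a \<in> carrier ?A" "x \<in> carrier G" "?D #> x = a"
      and b: "b \<in> carrier ?A" "y \<in> carrier G" "?D #> y = b"
    for a b x y
  proof -
    obtain c d where "c \<in> ?D" "x = c \<otimes> r a" "d \<in> ?D" "y = d \<otimes> r b"
      using r_coset[OF a] r_coset[OF b] by blast
    then show ?thesis using r[OF a(1)] r[OF b(1)] D.mem_carrier by (simp add: k_left k_right)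
  qed
  have r_mult: "?D #> (r a \<otimes> r b) = a \<otimes>\<^bsub>?A\<^esub> b" if "a \<in> carrier ?A" "b \<in> carrier ?A" for a b
    using r[OF that(1)] r[OF that(2)] coset_mult_abelianization by metis
  define f where "f a b = k (r a) (r b)" for a b
  have f_closed: "f a b \<in> carrier ?Q" if "a \<in> carrier ?A" "b \<in> carrier ?A" for a b
    using r[OF that(1)] r[OF that(2)] by (simp add: f_def)
  have f_left: "f (a \<otimes>\<^bsub>?A\<^esub> a') b = f a b \<otimes>\<^bsub>?Q\<^esub> f a' b"
    if "a \<in> carrier ?A" "a' \<in> carrier ?A" "b \<in> carrier ?A" for a a' b
  proof -
    note rs = r[OF that(1)] r[OF that(2)] r[OF that(3)]
    \<comment> \<open>The section need not be multiplicative, but \<open>r a \<otimes> r a'\<close>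
      is another lift of the product, so \<open>k_r\<close> applies.\<close>
    have "f (a \<otimes>\<^bsub>?A\<^esub> a') b = k (r a \<otimes> r a') (r b)"
      unfolding f_def using rs that r_mult[OF that(1,2)] A.m_closed[OF that(1,2)]
      by (intro k_r) (simp_all del: mult_FactGroup)
    then show ?thesis using k_mult_left rs by (simp add: f_def del: mult_FactGroup)
  qed
  have f_right: "f a (b \<otimes>\<^bsub>?A\<^esub> b') = f a b \<otimes>\<^bsub>?Q\<^esub> f a b'"
    if "a \<in> carrier ?A" "b \<in> carrier ?A" "b' \<in> carrier ?A" for a b b'
  proof -
    note rs = r[OF that(1)] r[OF that(2)] r[OF that(3)]
    have "f a (b \<otimes>\<^bsub>?A\<^esub> b') = k (r a) (r b \<otimes> r b')"
      unfolding f_def using rs that r_mult[OF that(2,3)] A.m_closed[OF that(2,3)]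
      by (intro k_r) (simp_all del: mult_FactGroup)
    then show ?thesis using k_mult_right rs by (simp add: f_def del: mult_FactGroup)
  qed
  have f_self: "f a a = \<one>\<^bsub>?Q\<^esub>" if "a \<in> carrier ?A" for a
    unfolding f_def using r[OF that] by (intro k_self) simp
  have "\<exists>\<sigma> \<in> hom (exterior_square ?A) ?Q.
      \<forall>a \<in> carrier ?A. \<forall>b \<in> carrier ?A. \<sigma> (wedge ?A a b) = f a b"
    by (rule Q.exterior_square_universal[of ?A f, OF A.is_monoid f_closed f_left f_right f_self])
      blast+
  then obtain \<sigma> where \<sigma>: "\<sigma> \<in> hom (exterior_square ?A) ?Q"
    and \<sigma>_wedge: "\<And>a b. a \<in> carrier ?A \<Longrightarrow> b \<in> carrier ?A \<Longrightarrow> \<sigma> (wedge ?A a b) = f a b"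
    by blast
  interpret \<sigma>: group_hom "exterior_square ?A" ?Q \<sigma>
    by (simp add: group_hom_def group_hom_axioms_def \<sigma>)
  \<comment> \<open>The projection of \<open>G \<and> G\<close> onto its quotient by M_0(G) factors
    through \<pi>. Whatever \<pi> kills is therefore killed by this projection, that is, lies in
    M_0(G).\<close>
  have \<sigma>\<pi>: "(\<sigma> \<circ> \<pi>) x = ?N #>\<^bsub>?E\<^esub> x" if "x \<in> carrier ?E" for x
  proof (rule hom_eq_on_generators[of ?E ?Q "\<sigma> \<circ> \<pi>", OF _ q.group_hom_axioms generate_nwedge _ _ that])
    show "group_hom ?E ?Q (\<sigma> \<circ> \<pi>)"
      using Group.hom_compose[OF \<pi>.homh \<sigma>] by (simp add: group_hom_def group_hom_axioms_def)
    fix s assume "s \<in> {nwedge G g h |g h. g \<in> carrier G \<and> h \<in> carrier G}"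
    then obtain g h where s: "s = nwedge G g h" "g \<in> carrier G" "h \<in> carrier G" by blast
    have "(\<sigma> \<circ> \<pi>) s = k (r (?D #> g)) (r (?D #> h))"
      using s by (simp add: \<pi>_nwedge \<sigma>_wedge f_def coset_in_abelianization)
    also have "\<dots> = k g h"
      using s by (intro k_r) (simp_all add: coset_in_abelianization)
    finally show "(\<sigma> \<circ> \<pi>) s = ?N #>\<^bsub>?E\<^esub> s" by (simp add: k_def s)
  qed (auto simp: nwedge_closed)
  show ?thesis
  proof
    fix x assume "x \<in> kernel ?E (exterior_square ?A) \<pi>"
    then have x: "x \<in> carrier ?E" "\<pi> x = \<one>\<^bsub>exterior_square ?A\<^esub>" by (auto simp: kernel_def)
    then have "?N #>\<^bsub>?E\<^esub> x = ?N" using \<sigma>\<pi>[OF x(1)] \<sigma>.hom_one by simp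
    then show "x \<in> ?N" using E.rcos_self[OF x(1) N.subgroup_axioms] by simp
  qed
qed

end

section \<open>The isomorphism induced by \<pi>\<close>

theorem proposition3p1:
  fixes G :: "('a, 'b) monoid_scheme"
    and \<beta> :: "('a set \<times> 'a set \<Rightarrow>\<^sub>0 int) set \<Rightarrow> 'a"
  assumes "group G"
    and "finitely_generated_group G"
    and "torsion_free_group G"
    and "nilpotent_of_class G 2"
    and "torsion_free_group (abelianization G)"
    and "\<beta> \<in> epi (exterior_square (abelianization G)) (derived_group G)"
    and "\<And>g h. g \<in> carrier G \<Longrightarrow> h \<in> carrier G \<Longrightarrow>
           \<beta> (wedge (abelianization G) (derived_subgroup G #>\<^bsub>G\<^esub> g) (derived_subgroup G #>\<^bsub>G\<^esub> h))
             = commutator G g h"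
  shows "bogomolov_multiplier G \<cong>
           (exterior_square (abelianization G))
             \<lparr>carrier := kernel (exterior_square (abelianization G)) (derived_group G) \<beta>\<rparr>
           Mod decomposable_kernel (abelianization G) (derived_group G) \<beta>"
proof -
  interpret group G by fact
  let ?E = "nonabelian_exterior_square G" and ?A = "abelianization G" and ?D = "derived_subgroup G"
  let ?\<Lambda> = "exterior_square ?A" and ?C = "derived_group G"
  let ?\<kappa> = "commutator_map G"
  let ?M = "schur_multiplier G" and ?Z = "schur_multiplier_0 G"
  let ?L = "?\<Lambda>\<lparr>carrier := kernel ?\<Lambda> ?C \<beta>\<rparr>" and ?D\<beta> = "decomposable_kernel ?A ?C \<beta>"
  let ?W = "{nwedge G x y |x y. x \<in> carrier G \<and> y \<in> carrier G \<and> commutator G x y = \<one>\<^bsub>G\<^esub>}"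
  let ?V = "{wedge ?A a b |a b. a \<in> carrier ?A \<and> b \<in> carrier ?A \<and> \<beta> (wedge ?A a b) = \<one>\<^bsub>?C\<^esub>}"
  note nil = \<open>nilpotent_of_class G 2\<close>
  interpret A: comm_group ?A by (rule derived_quot_is_comm_group)
  interpret E: comm_group ?E by (rule comm_group_exterior_square_class2[OF nil])
  interpret \<Lambda>: comm_group ?\<Lambda> by (rule comm_group_exterior_square[OF A.is_monoid])
  have C: "group ?C"
    by (rule subgroup_imp_group[OF normal_imp_subgroup[OF derived_self_is_normal]])
  interpret \<beta>: group_hom ?\<Lambda> ?C \<beta>
    using assms(6) C by (simp add: epi_def group_hom_def group_hom_axioms_def)
  interpret \<kappa>: group_hom ?E ?C ?\<kappa>
    using commutator_map_hom(1) C by (simp add: group_hom_def group_hom_axioms_def)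
  obtain \<pi> where \<pi>: "group_hom ?E ?\<Lambda> \<pi>"
    and \<pi>_nwedge: "\<And>g h. g \<in> carrier G \<Longrightarrow> h \<in> carrier G \<Longrightarrow>
      \<pi> (nwedge G g h) = wedge ?A (?D #>\<^bsub>G\<^esub> g) (?D #>\<^bsub>G\<^esub> h)"
    using exterior_square_abelianization_exists by blast
  interpret \<pi>: group_hom ?E ?\<Lambda> \<pi> by (rule \<pi>)
  \<comment> \<open>Both sides are homomorphisms that send \<open>g \<and> h\<close> to
    \<open>[g, h]\<close>, by the hypothesis on \<beta> and by
    \<open>commutator_map_hom\<close>.\<close>
  have \<beta>\<pi>: "\<beta> (\<pi> x) = ?\<kappa> x" if "x \<in> carrier ?E" for x
  proof -
    have "(\<beta> \<circ> \<pi>) x = ?\<kappa> x"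
    proof (rule hom_eq_on_generators[of ?E ?C "\<beta> \<circ> \<pi>", OF _ \<kappa>.group_hom_axioms generate_nwedge _ _ that])
      show "group_hom ?E ?C (\<beta> \<circ> \<pi>)"
        using Group.hom_compose[OF \<pi>.homh \<beta>.homh] C by (simp add: group_hom_def group_hom_axioms_def)
    qed (auto simp: nwedge_closed \<pi>_nwedge assms(7) commutator_map_hom(2))
    then show ?thesis by simp
  qed
  have onto: "\<pi> ` carrier ?E = carrier ?\<Lambda>"
  proof -
    have img: "\<pi> ` {nwedge G g h |g h. g \<in> carrier G \<and> h \<in> carrier G}
        = {wedge ?A a b |a b. a \<in> carrier ?A \<and> b \<in> carrier ?A}"
      using \<pi>_nwedge by (force simp: coset_in_abelianization elim!: abelianization_cases)
    have sub: "{nwedge G g h |g h. g \<in> carrier G \<and> h \<in> carrier G} \<subseteq> carrier ?E"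
      by (auto simp: nwedge_closed)
    show ?thesis
      using \<pi>.generate_img[OF sub]
      unfolding img generate_nwedge generate_wedge[OF A.is_monoid] by simp
  qed
  \<comment> \<open>Equality already holds for the generating sets: if \<beta> kills
    \<open>a \<and> b\<close>, then any lifts \<open>x\<close>, \<open>y\<close> commute, because
    \<beta> takes the value \<open>[x, y]\<close> there. Passing to generated subgroups gives
    \<open>\<pi>Z\<close>.\<close>
  have "\<pi> ` ?W = ?V"
  proof
    show "\<pi> ` ?W \<subseteq> ?V"
    proof clarify
      fix x y assume "x \<in> carrier G" "y \<in> carrier G" "commutator G x y = \<one>\<^bsub>G\<^esub>"
      then show "\<exists>a b. \<pi> (nwedge G x y) = wedge ?A a b \<and> a \<in> carrier ?A \<and> b \<in> carrier ?A
          \<and> \<beta> (wedge ?A a b) = \<one>\<^bsub>?C\<^esub>"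
        by (intro exI[of _ "?D #>\<^bsub>G\<^esub> x"] exI[of _ "?D #>\<^bsub>G\<^esub> y"])
          (simp add: \<pi>_nwedge coset_in_abelianization assms(7))
    qed
    show "?V \<subseteq> \<pi> ` ?W"
    proof clarify
      fix a b assume "a \<in> carrier ?A" "b \<in> carrier ?A" and 1: "\<beta> (wedge ?A a b) = \<one>\<^bsub>?C\<^esub>"
      then obtain x y where xy: "x \<in> carrier G" "y \<in> carrier G"
        and ab: "a = ?D #>\<^bsub>G\<^esub> x" "b = ?D #>\<^bsub>G\<^esub> y" by (meson abelianization_cases)
      then have "commutator G x y = \<one>\<^bsub>G\<^esub>" using 1 assms(7) by simp
      then show "wedge ?A a b \<in> \<pi> ` ?W"
        using xy ab \<pi>_nwedge[OF xy] by (intro image_eqI[of _ _ "nwedge G x y"]) auto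
    qed
  qed
  moreover have W: "?W \<subseteq> carrier ?E" by (auto simp: nwedge_closed)
  ultimately have \<pi>Z: "\<pi> ` ?Z = ?D\<beta>"
    unfolding schur_multiplier_0_def decomposable_kernel_def using \<pi>.generate_img[OF W] by simp
  have "?W \<subseteq> kernel ?E ?C ?\<kappa>"
    by (auto simp: kernel_def nwedge_closed commutator_map_hom(2))
  then have ZM: "?Z \<subseteq> carrier ?M"
    unfolding schur_multiplier_0_def schur_multiplier_def
    using E.generate_subgroup_incl[OF _ \<kappa>.subgroup_kernel] by simp
  \<comment> \<open>By \<open>\<pi>Z\<close> every element here is the image of an element of
    M_0(G), which \<kappa> kills, so \<beta> kills the image by \<open>\<beta>\<pi>\<close>.\<close>
  have D\<beta>L: "?D\<beta> \<subseteq> carrier ?L"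
    using ZM \<beta>\<pi> unfolding \<pi>Z[symmetric] schur_multiplier_def by (auto simp: kernel_def)
  have L: "subgroup (kernel ?\<Lambda> ?C \<beta>) ?\<Lambda>" by (rule \<beta>.subgroup_kernel)
  have M: "subgroup (kernel ?E ?C ?\<kappa>) ?E" by (rule \<kappa>.subgroup_kernel)
  interpret M: group ?M
    unfolding schur_multiplier_def by (rule E.subgroup_imp_group[OF M])
  interpret L: comm_group ?L
    by (rule group.group_comm_groupI[OF \<Lambda>.subgroup_imp_group[OF L]])
      (use subgroup.mem_carrier[OF L] \<Lambda>.m_comm in simp)
  have "subgroup ?D\<beta> ?\<Lambda>"
    unfolding decomposable_kernel_def
    by (rule \<Lambda>.generate_is_subgroup) (auto simp: wedge_closed)
  then have "subgroup ?D\<beta> ?L"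
    using \<Lambda>.subgroup_incl[OF _ L] D\<beta>L by simp
  then interpret D\<beta>: normal ?D\<beta> ?L by (simp add: L.normal_iff_subgroup)
  \<comment> \<open>The map \<pi> followed by the projection modulo \<open>?D\<beta>\<close>. The
    first isomorphism theorem applies once this map is shown to be onto with kernel M_0(G).\<close>
  let ?\<psi> = "\<lambda>x. ?D\<beta> #>\<^bsub>?L\<^esub> \<pi> x"
  have \<pi>_hom: "\<pi> \<in> hom ?M ?L"
    by (rule homI) (auto simp: schur_multiplier_def kernel_def \<beta>\<pi>)
  interpret \<psi>: group_hom ?M "?L Mod ?D\<beta>" ?\<psi>
    using Group.hom_compose[OF \<pi>_hom D\<beta>.r_coset_hom_Mod] D\<beta>.factorgroup_is_group M.is_group
    by (simp add: group_hom_def group_hom_axioms_def comp_def)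
  have "?\<psi> ` carrier ?M = carrier (?L Mod ?D\<beta>)"
  proof -
    have "\<pi> ` carrier ?M = carrier ?L"
    proof
      show "\<pi> ` carrier ?M \<subseteq> carrier ?L" using \<pi>_hom by (auto simp: hom_def)
      \<comment> \<open>A preimage in \<open>G \<and> G\<close> exists by \<open>onto\<close>, and
        \<open>\<beta>\<pi>\<close> forces it into the kernel of \<kappa>.\<close>
      show "carrier ?L \<subseteq> \<pi> ` carrier ?M"
      proof
        fix l assume "l \<in> carrier ?L"
        then have l: "l \<in> carrier ?\<Lambda>" "\<beta> l = \<one>\<^bsub>?C\<^esub>" by (simp_all add: kernel_def)
        then obtain x where x: "x \<in> carrier ?E" "l = \<pi> x" using onto by blast
        then have "x \<in> carrier ?M"
          using l(2) \<beta>\<pi>[OF x(1)] by (simp add: schur_multiplier_def kernel_def)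
        then show "l \<in> \<pi> ` carrier ?M" using x(2) by blast
      qed
    qed
    then have "(\<lambda>l. ?D\<beta> #>\<^bsub>?L\<^esub> l) ` \<pi> ` carrier ?M = carrier (?L Mod ?D\<beta>)"
      unfolding carrier_FactGroup by simp
    then show ?thesis by (simp only: image_image)
  qed
  moreover have "kernel ?M (?L Mod ?D\<beta>) ?\<psi> = ?Z"
  proof
    show "?Z \<subseteq> kernel ?M (?L Mod ?D\<beta>) ?\<psi>"
    proof
      fix x assume x: "x \<in> ?Z"
      then have "\<pi> x \<in> ?D\<beta>" using \<pi>Z by blast
      then have "?\<psi> x = ?D\<beta>" by (rule D\<beta>.rcos_const[OF L.is_group])
      then show "x \<in> kernel ?M (?L Mod ?D\<beta>) ?\<psi>"
        using x ZM unfolding kernel_def one_FactGroup by blast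
    qed
    show "kernel ?M (?L Mod ?D\<beta>) ?\<psi> \<subseteq> ?Z"
    proof
      fix x assume "x \<in> kernel ?M (?L Mod ?D\<beta>) ?\<psi>"
      then have xM: "x \<in> carrier ?M" and *: "?D\<beta> #>\<^bsub>?L\<^esub> \<pi> x = ?D\<beta>" by (auto simp: kernel_def)
      have "\<pi> x \<in> carrier ?L" using \<pi>_hom xM by (auto simp: hom_def)
      then have "\<pi> x \<in> ?D\<beta>" using * L.rcos_self[OF _ D\<beta>.subgroup_axioms] by metis
      \<comment> \<open>Correcting \<open>x\<close> by some \<open>y\<close> from M_0(G) with the
        same image leaves an element of the kernel of \<pi>, which lies in M_0(G) by
        \<open>kernel_subset_schur_multiplier_0\<close>.\<close>
      then obtain y where y: "y \<in> ?Z" "\<pi> x = \<pi> y" using \<pi>Z by (metis imageE)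
      interpret Z: subgroup ?Z ?E by (rule subgroup_schur_multiplier_0)
      have x: "x \<in> carrier ?E" using xM by (simp add: schur_multiplier_def kernel_def)
      have ycarr: "y \<in> carrier ?E" using y(1) by (rule Z.mem_carrier)
      have "x \<otimes>\<^bsub>?E\<^esub> inv\<^bsub>?E\<^esub> y \<in> kernel ?E ?\<Lambda> \<pi>"
        using x y(2) ycarr by (simp add: kernel_def)
      then have "x \<otimes>\<^bsub>?E\<^esub> inv\<^bsub>?E\<^esub> y \<in> ?Z"
        using kernel_subset_schur_multiplier_0[OF nil \<pi> \<pi>_nwedge] by blast
      then have "x \<otimes>\<^bsub>?E\<^esub> inv\<^bsub>?E\<^esub> y \<otimes>\<^bsub>?E\<^esub> y \<in> ?Z" using y(1) by (rule Z.m_closed)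
      then show "x \<in> ?Z" using x ycarr by (simp add: E.m_assoc)
    qed
  qed
  ultimately show ?thesis
    unfolding bogomolov_multiplier_def using \<psi>.FactGroup_iso by simp
qed

end
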